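(* Let $P$ be a distribution on $\mathbb{R}^d$ with $\mathbb{E}_P[\|\mathbf{x}\|_2]<\infty$, let $\epsilon\ge 0$, and suppose $C:\mathbb{R}^d\times\mathbb{R}^d\to\mathbb{R}$ is a non-negative, lower semi-continuous cost function satisfying $C(\mathbf{x},\mathbf{y})=0$ if and only if $\mathbf{x}=\mathbf{y}$. Then the optimization formulation $$\text{(A)}\qquad \underset{K\ \text{star body}}{\mathrm{argmin}}\ \Big[\max_{Q:\ d_W(Q,P)\le\epsilon}\ \mathbb{E}_Q[\|\mathbf{x}\|_K]\Big]\quad\text{s.t.}\quad \mathrm{vol}(K)=1$$ is equivalent to the following: $$\text{(B)}\qquad \underset{K,\ s,\ \lambda\in L^1(\mathrm{d}P)}{\mathrm{argmin}}\ \ s\,\epsilon+\int\lambda(\mathbf{x})\,\mathrm{d}P(\mathbf{x})\quad\text{s.t.}\quad sC(\mathbf{x},\mathbf{y})+\lambda(\mathbf{x})\ge\|\mathbf{y}\|_K\ \ \forall\,(\mathbf{x},\mathbf{y}),\quad s\ge 0,\quad \mathrm{vol}(K)\le 1,$$ where $K$ ranges over star bodies and $s$ over scalars.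
   Context: A set $K\subset\mathbb{R}^d$ is star if $[\mathbf{0},\mathbf{y}]\subset K$ for every $\mathbf{y}\in K$. A star body is a compact star set $K$ with nonempty interior such that for every $\mathbf{x}\ne\mathbf{0}$ the ray $\{\lambda\mathbf{x}:\lambda>0\}$ intersects the boundary of $K$ exactly once. The gauge of $K$ is $\|\mathbf{x}\|_K=\inf\{\lambda\ge 0:\mathbf{x}\in\lambda K\}$, and $\mathrm{vol}$ is $d$-dimensional volume. For distributions $P,Q$ on $\mathbb{R}^d$ and the cost $C$, $d_W(Q,P):=\inf_{\beta\in\Gamma(Q,P)}\mathbb{E}_{(X,Y)\sim\beta}[C(X,Y)]$, where $\Gamma(Q,P)$ is the set of all couplings between $Q$ and $P$. $L^1(\mathrm{d}P):=\{f:\int|f(\mathbf{x})|\,\mathrm{d}P(\mathbf{x})<\infty\}$. The inner "max" in (A) is understood as a supremum.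
   Formalization: At ε=0 the claim fails as stated: equivalence is shown if (B) is feasible, after the infimum over s, λ, or with s=∞ allowed; if P is the point mass at 0, only bodies with vol(K)=1 are compared. λ may be infinite on P-null sets; couplings have X~P, Y~Q. *)

theory Defs
  imports "HOL-Probability.Probability"
begin

definition star_set :: "'a::real_vector set \<Rightarrow> bool" where
  "star_set K \<longleftrightarrow> (\<forall>y\<in>K. closed_segment 0 y \<subseteq> K)"

definition star_body :: "'a::euclidean_space set \<Rightarrow> bool" where
  "star_body K \<longleftrightarrow> compact K \<and> star_set K \<and> interior K \<noteq> {} \<and>
     (\<forall>x. x \<noteq> 0 \<longrightarrow> (\<exists>!z. z \<in> {t *\<^sub>R x | t. t > 0} \<inter> frontier K))"

definition star_gauge :: "'a::real_vector set \<Rightarrow> 'a \<Rightarrow> real" where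
  "star_gauge K x = Inf {t. t \<ge> 0 \<and> x \<in> (\<lambda>z. t *\<^sub>R z) ` K}"

definition lsc :: "('a::topological_space \<Rightarrow> real) \<Rightarrow> bool" where
  "lsc f \<longleftrightarrow> (\<forall>x a. a < f x \<longrightarrow> (\<forall>\<^sub>F y in nhds x. a < f y))"

definition distribution :: "'a::euclidean_space measure \<Rightarrow> bool" where
  "distribution P \<longleftrightarrow> prob_space P \<and> sets P = sets borel"

(* C need not be symmetric, so the order of the marginals matters.  The first coordinate of
   a coupling has law P and the second has law Q; this is the orientation that matches the
   constraint s C(x,y) + \<lambda>(x) \<ge> ||y||_K, where \<lambda> is integrated against P. *)
definition couplings ::
    "'a::euclidean_space measure \<Rightarrow> 'a measure \<Rightarrow> ('a \<times> 'a) measure set" where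
  "couplings Q P = {\<beta>. distribution \<beta> \<and> distr \<beta> borel fst = P \<and> distr \<beta> borel snd = Q}"

definition transport_cost ::
    "('a::euclidean_space \<times> 'a \<Rightarrow> real) \<Rightarrow> 'a measure \<Rightarrow> 'a measure \<Rightarrow> ennreal" where
  "transport_cost C Q P = (INF \<beta>\<in>couplings Q P. \<integral>\<^sup>+ z. ennreal (C z) \<partial>\<beta>)"

definition ambiguity_ball ::
    "('a::euclidean_space \<times> 'a \<Rightarrow> real) \<Rightarrow> real \<Rightarrow> 'a measure \<Rightarrow> 'a measure set" where
  "ambiguity_ball C \<epsilon> P = {Q. distribution Q \<and> transport_cost C Q P \<le> ennreal \<epsilon>}"

(* The functions are extended-real valued: an element of L^1(dP) may be infinite on a P-null
   set.  This matters because the dual constraint is imposed at every point. *)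
definition L1 :: "'a measure \<Rightarrow> ('a \<Rightarrow> ereal) set" where
  "L1 P = {f \<in> borel_measurable P. (\<integral>\<^sup>+ x. e2ennreal \<bar>f x\<bar> \<partial>P) < \<infinity>}"

(* The set of minimizers, with the usual convention that it is empty if f is identically
   \<infinity> on S. *)
definition argmin_set :: "('b \<Rightarrow> ereal) \<Rightarrow> 'b set \<Rightarrow> 'b set" where
  "argmin_set f S = {x. is_arg_min f (\<lambda>x. x \<in> S) x \<and> f x < \<infinity>}"

definition A_feasible :: "'a::euclidean_space set set" where
  "A_feasible = {K. star_body K \<and> emeasure lborel K = 1}"

definition A_objective ::
    "('a::euclidean_space \<times> 'a \<Rightarrow> real) \<Rightarrow> real \<Rightarrow> 'a measure \<Rightarrow> 'a set \<Rightarrow> ereal" where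
  "A_objective C \<epsilon> P K =
     enn2ereal (SUP Q\<in>ambiguity_ball C \<epsilon> P. \<integral>\<^sup>+ x. ennreal (star_gauge K x) \<partial>Q)"

definition A_value :: "('a::euclidean_space \<times> 'a \<Rightarrow> real) \<Rightarrow> real \<Rightarrow> 'a measure \<Rightarrow> ereal" where
  "A_value C \<epsilon> P = (INF K\<in>A_feasible. A_objective C \<epsilon> P K)"

definition A_argmin ::
    "('a::euclidean_space \<times> 'a \<Rightarrow> real) \<Rightarrow> real \<Rightarrow> 'a measure \<Rightarrow> 'a set set" where
  "A_argmin C \<epsilon> P = argmin_set (A_objective C \<epsilon> P) A_feasible"

(* S is the range of the scalar s: {0..<\<infinity>} for ordinary scalars s \<ge> 0, or {0..} if the
   limiting multiplier s = \<infinity> is admitted as well, with \<infinity> * 0 = 0.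
   If 0 < \<epsilon> then s = \<infinity> has infinite objective, so it can only matter if \<epsilon> = 0. *)
definition B_feasible ::
    "ereal set \<Rightarrow> ('a::euclidean_space \<times> 'a \<Rightarrow> real) \<Rightarrow> 'a measure
      \<Rightarrow> ('a set \<times> ereal \<times> ('a \<Rightarrow> ereal)) set" where
  "B_feasible S C P = {(K, s, l). star_body K \<and> s \<in> S \<and> l \<in> L1 P \<and>
     (\<forall>x y. s * ereal (C (x, y)) + l x \<ge> ereal (star_gauge K y)) \<and>
     emeasure lborel K \<le> 1}"

definition B_objective ::
    "real \<Rightarrow> 'a measure \<Rightarrow> 'a set \<times> ereal \<times> ('a \<Rightarrow> ereal) \<Rightarrow> ereal" where
  "B_objective \<epsilon> P = (\<lambda>(K, s, l). s * ereal \<epsilon> + ereal (LINT x|P. real_of_ereal (l x)))"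

definition B_value ::
    "ereal set \<Rightarrow> ('a::euclidean_space \<times> 'a \<Rightarrow> real) \<Rightarrow> real \<Rightarrow> 'a measure \<Rightarrow> ereal" where
  "B_value S C \<epsilon> P = (INF z\<in>B_feasible S C P. B_objective \<epsilon> P z)"

definition B_argmin ::
    "ereal set \<Rightarrow> ('a::euclidean_space \<times> 'a \<Rightarrow> real) \<Rightarrow> real \<Rightarrow> 'a measure
      \<Rightarrow> ('a set \<times> ereal \<times> ('a \<Rightarrow> ereal)) set" where
  "B_argmin S C \<epsilon> P = argmin_set (B_objective \<epsilon> P) (B_feasible S C P)"

(* The bodies that are optimal for the dual problem after the infimum over s and \<lambda> has been taken; unlike
   membership in fst ` B_argmin this does not require that infimum to be attained. *)
definition B_optimal_bodies ::
    "ereal set \<Rightarrow> ('a::euclidean_space \<times> 'a \<Rightarrow> real) \<Rightarrow> real \<Rightarrow> 'a measure \<Rightarrow> 'a set set" where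
  "B_optimal_bodies S C \<epsilon> P =
     argmin_set (\<lambda>K. INF z\<in>{z \<in> B_feasible S C P. fst z = K}. B_objective \<epsilon> P z)
       {K. star_body K \<and> emeasure lborel K \<le> 1}"

end

theory Submission
  imports Defs
begin

text \<open>
  Fix a star body \<open>K\<close>. Its gauge \<open>g\<close> is continuous and comparable to the norm. Weak duality is obtained
  by integrating the dual constraint against a coupling. For strong duality with \<open>\<epsilon> > 0\<close>, the set of
  pairs (cost, expected gauge) realised by transport plans from \<open>P\<close> is convex, so it is supported
  from above by a line of some slope \<open>s\<close> through the point given by \<open>\<epsilon>\<close> and the worst case value;
  \<open>s > 0\<close>, because the expected gauge is unbounded over the plans of finite cost. The optimal \<open>\<lambda>\<close> is
  \<open>\<lambda> x = (SUP y. g y - s * C (x, y))\<close>. Since \<open>C\<close> is only lower semicontinuous, its integral is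
  controlled by transporting along measurable selections of the maximizers over large balls.

  For \<open>\<epsilon> = 0\<close> the ambiguity ball is \<open>{P}\<close>. Then \<open>s = \<infinity>\<close> with \<open>\<lambda> = g\<close> is optimal, and if some finite
  \<open>s\<close> is feasible, the transforms \<open>\<lambda>\<close> decrease to \<open>g\<close> as \<open>s\<close> grows.

  Finally, rescaling \<open>K\<close> to unit volume divides the gauge by a factor \<open>c \<ge> 1\<close>, which identifies the
  constraints \<open>vol K = 1\<close> and \<open>vol K \<le> 1\<close> as soon as the objective is positive.
\<close>

section \<open>Star bodies and their gauges\<close>

text \<open>A supporting line could in principle be vertical. For \<open>\<epsilon> > 0\<close> this
  is excluded by the identity plan: it has cost 0, strictly left of \<open>\<epsilon>\<close>, and a
  finite expected gauge because \<open>P\<close> has a first moment. For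
  \<open>\<epsilon> = 0\<close> no point lies further left; \<open>s = \<infinity>\<close> then
  plays the role of the vertical line, while finite multipliers may only approach the infimum or may
  not be feasible at all. A positive slope matters because a selected target gains at least
  \<open>g x >= 0\<close>. So \<open>s * C\<close> is at most the gauge of the target, and dividing
  by \<open>s\<close> shows that the selected plan has finite cost and can be compared with the
  line. Balls are used because the supremum defining \<lambda> need not be attained on the whole
  space. The selections also turn this supremum over uncountably many points into a countable one,
  which makes it measurable. The objective of (A) vanishes only if \<open>\<epsilon> = 0\<close> and
  \<open>P\<close> is the point mass at the origin. Then every body has value 0, and the volume
  constraint of (B) need not be tight at an optimum.\<close>

lemma star_body_zero_in: "star_body K \<Longrightarrow> 0 \<in> K"
  unfolding star_body_def star_set_def
  by (metis Int_iff all_not_in_conv ends_in_segment(1) inf.orderE interior_subset subsetD)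

lemma star_body_shrink:
  assumes "star_body K" "y \<in> K" "0 \<le> t" "t \<le> 1"
  shows "t *\<^sub>R y \<in> K"
proof -
  have "t *\<^sub>R y \<in> closed_segment 0 y"
    using assms by (auto simp: in_segment)
  then show ?thesis using assms unfolding star_body_def star_set_def by blast
qed

lemma star_body_absorbs:
  assumes "star_body K"
  obtains t where "t > 0" "x \<in> (\<lambda>z. t *\<^sub>R z) ` K"
proof (cases "x = 0")
  case True
  then show ?thesis using star_body_zero_in[OF assms] that[of 1] by auto
next
  case False
  then obtain u where u: "u > 0" "u *\<^sub>R x \<in> frontier K"
    using assms unfolding star_body_def by blast
  have "closed K" using assms compact_imp_closed unfolding star_body_def by blast
  then have "u *\<^sub>R x \<in> K" using u frontier_subset_closed by blast
  then have "x \<in> (\<lambda>z. (1/u) *\<^sub>R z) ` K" using u by (intro image_eqI[of _ _ "u *\<^sub>R x"]) auto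
  then show ?thesis using u that[of "1/u"] by auto
qed

text \<open>The infimum is attained. Starness makes the set of admissible factors upward closed,
  boundedness of \<open>K\<close> keeps the infimum \<open>\<tau>\<close> positive for
  \<open>x \<noteq> 0\<close>, and closedness of \<open>K\<close> passes to the limit along factors
  decreasing to \<open>\<tau>\<close>.\<close>

lemma star_gauge_le_iff:
  assumes K: "star_body K" and t: "0 \<le> t"
  shows "star_gauge K x \<le> t \<longleftrightarrow> x \<in> (\<lambda>z. t *\<^sub>R z) ` K"
proof -
  define A where "A = {t. t \<ge> 0 \<and> x \<in> (\<lambda>z. t *\<^sub>R z) ` K}"
  define \<tau> where "\<tau> = Inf A"
  have g: "star_gauge K x = \<tau>" unfolding star_gauge_def \<tau>_def A_def ..
  obtain t0 where "t0 \<in> A" using star_body_absorbs[OF K, of x] unfolding A_def by force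
  have bdd: "bdd_below A" unfolding A_def by (rule bdd_belowI[of _ 0]) auto
  have up: "s' \<in> A" if "s \<in> A" "s \<le> s'" for s s'
  proof (cases "s' = 0")
    case False
    from that obtain k where k: "k \<in> K" "x = s *\<^sub>R k" "0 \<le> s" unfolding A_def by auto
    with False that have "(s / s') *\<^sub>R k \<in> K"
      by (intro star_body_shrink[OF K]) (auto simp: divide_simps)
    then show ?thesis unfolding A_def using k False that
      by (auto intro!: image_eqI[of _ _ "(s / s') *\<^sub>R k"])
  next
    case True
    then show ?thesis using that unfolding A_def by auto
  qed
  have tau0: "0 \<le> \<tau>" unfolding \<tau>_def using \<open>t0 \<in> A\<close>
    by (intro cInf_greatest) (auto simp: A_def)
  have above: "s \<in> A" if "\<tau> < s" for s
    using that up cInf_lessD[of A s] \<open>t0 \<in> A\<close> unfolding \<tau>_def by (metis empty_iff less_imp_le)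
  have mem: "\<tau> \<in> A"
  proof (cases "x = 0")
    case True
    then have "0 \<in> A" using star_body_zero_in[OF K] unfolding A_def by auto
    then have "\<tau> = 0" using tau0 cInf_lower[OF _ bdd] unfolding \<tau>_def by force
    with \<open>0 \<in> A\<close> show ?thesis by simp
  next
    case False
    have "bounded K" using K compact_imp_bounded unfolding star_body_def by blast
    then obtain R where R: "R > 0" "\<And>z. z \<in> K \<Longrightarrow> norm z \<le> R"
      unfolding bounded_pos by blast
    have "norm x / R \<le> s" if "s \<in> A" for s
    proof -
      from that obtain k where "k \<in> K" "x = s *\<^sub>R k" "0 \<le> s" unfolding A_def by auto
      then have "norm x \<le> s * R" using R(2)[of k] by (auto intro: mult_left_mono)
      then show ?thesis using R by (simp add: divide_simps)
    qed
    then have "norm x / R \<le> \<tau>" unfolding \<tau>_def using \<open>t0 \<in> A\<close> by (intro cInf_greatest) auto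
    moreover have "0 < norm x / R" using False R by simp
    ultimately have pos: "\<tau> > 0" by linarith
    define r where "r n = \<tau> + inverse (real (Suc n))" for n
    have "r n \<in> A" for n by (rule above) (simp add: r_def)
    have "inverse (r n) *\<^sub>R x \<in> K" for n
    proof -
      have "r n > 0" using pos unfolding r_def by (simp add: add_pos_pos)
      then show ?thesis using \<open>r n \<in> A\<close> unfolding A_def by auto
    qed
    moreover have "(\<lambda>n. inverse (r n) *\<^sub>R x) \<longlonglongrightarrow> inverse (\<tau> + 0) *\<^sub>R x"
      unfolding r_def using pos by (intro tendsto_intros LIMSEQ_inverse_real_of_nat) auto
    moreover have "closed K" using K compact_imp_closed unfolding star_body_def by blast
    ultimately have "inverse \<tau> *\<^sub>R x \<in> K" unfolding closed_sequential_limits by force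
    then show ?thesis using pos unfolding A_def by (auto intro!: image_eqI[of _ _ "inverse \<tau> *\<^sub>R x"])
  qed
  have "\<tau> \<le> t \<longleftrightarrow> t \<in> A"
    using up[OF mem] cInf_lower[OF _ bdd] unfolding \<tau>_def by blast
  then show ?thesis using t unfolding g A_def by auto
qed

lemma star_gauge_nonneg:
  assumes K: "star_body K"
  shows "0 \<le> star_gauge K x"
  unfolding star_gauge_def
proof (rule cInf_greatest)
  show "{t. t \<ge> 0 \<and> x \<in> (\<lambda>z. t *\<^sub>R z) ` K} \<noteq> {}"
    using star_body_absorbs[OF K, of x] by force
qed auto

lemma star_gauge_eq_zero_iff:
  assumes "star_body K"
  shows "star_gauge K x = 0 \<longleftrightarrow> x = 0"
  using star_gauge_le_iff[OF assms, of 0 x] star_gauge_nonneg[OF assms, of x] star_body_zero_in[OF assms]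
  by auto

lemma star_gauge_scaleR:
  assumes K: "star_body K" and c: "0 < c"
  shows "star_gauge K (c *\<^sub>R x) = c * star_gauge K x"
proof -
  have "star_gauge K (c *\<^sub>R x) \<le> c * t \<longleftrightarrow> star_gauge K x \<le> t" if "0 \<le> t" for t
  proof -
    have "c *\<^sub>R x \<in> (\<lambda>z. (c * t) *\<^sub>R z) ` K \<longleftrightarrow> x \<in> (\<lambda>z. t *\<^sub>R z) ` K"
      using c by (auto simp: image_iff simp flip: scaleR_scaleR)
    then show ?thesis using that c by (simp add: star_gauge_le_iff[OF K])
  qed
  from this[of "star_gauge K x"] this[of "star_gauge K (c *\<^sub>R x) / c"] show ?thesis
    using c star_gauge_nonneg[OF K] by (simp add: field_simps antisym)
qed

lemma star_gauge_image_scaleR: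
  assumes K: "star_body K" and c: "0 < c"
  shows "star_gauge ((*\<^sub>R) c ` K) x = star_gauge K x / c"
proof -
  have "x \<in> (\<lambda>z. t *\<^sub>R z) ` (*\<^sub>R) c ` K \<longleftrightarrow> inverse c *\<^sub>R x \<in> (\<lambda>z. t *\<^sub>R z) ` K" for t
  proof -
    have "x = t *\<^sub>R c *\<^sub>R z \<longleftrightarrow> inverse c *\<^sub>R x = t *\<^sub>R z" for z
    proof -
      have "x = c *\<^sub>R y \<longleftrightarrow> inverse c *\<^sub>R x = y" for y using c by auto
      then show ?thesis by (simp only: scaleR_left_commute[of t c])
    qed
    then show ?thesis by (auto simp: image_iff)
  qed
  then have "star_gauge ((*\<^sub>R) c ` K) x = star_gauge K (inverse c *\<^sub>R x)"
    unfolding star_gauge_def by simp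
  then show ?thesis using star_gauge_scaleR[OF K, of "inverse c" x] c by (simp add: divide_inverse mult.commute)
qed

text \<open>Uniqueness of the boundary point on a ray enters here. The point \<open>k\<close> of
  gauge 1 is a boundary point; a second point of \<open>K\<close> on the same ray must therefore be
  interior.\<close>

lemma star_gauge_less_imp_interior:
  assumes K: "star_body K" and x: "x \<noteq> 0" and t: "star_gauge K x < t"
  shows "inverse t *\<^sub>R x \<in> interior K"
proof -
  define u where "u = star_gauge K x"
  have u: "0 < u" "u < t"
    using star_gauge_nonneg[OF K, of x] star_gauge_eq_zero_iff[OF K, of x] x t
    unfolding u_def by auto
  define k where "k = inverse u *\<^sub>R x"
  have "star_gauge K k = 1" unfolding k_def using u by (simp add: star_gauge_scaleR[OF K] u_def)
  have mem: "star_gauge K y \<le> 1 \<longleftrightarrow> y \<in> K" for y using star_gauge_le_iff[OF K, of 1 y] by simp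
  have "k \<in> K" using mem[of k] \<open>star_gauge K k = 1\<close> by linarith
  have clo: "closed K" using K compact_imp_closed unfolding star_body_def by blast
  have "k \<notin> interior K"
  proof
    assume "k \<in> interior K"
    then obtain e where e: "e > 0" "ball k e \<subseteq> K" using mem_interior by blast
    have "k \<noteq> 0" using u x unfolding k_def by simp
    \<comment> \<open>The factor \<open>1 + s\<close> moves \<open>k\<close> outwards by exactly
      \<open>e / 2\<close>, which stays in the ball but has gauge above 1.\<close>
    define s where "s = e / (2 * norm k)"
    have s: "s > 0" using e \<open>k \<noteq> 0\<close> unfolding s_def by simp
    have "dist k ((1 + s) *\<^sub>R k) = s * norm k"
      using s by (simp add: dist_norm algebra_simps)
    also have "\<dots> < e" using \<open>k \<noteq> 0\<close> e unfolding s_def by simp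
    finally have "(1 + s) *\<^sub>R k \<in> K" using e by auto
    then have "star_gauge K ((1 + s) *\<^sub>R k) \<le> 1" using mem by simp
    then show False using s star_gauge_scaleR[OF K, of "1 + s" k] \<open>star_gauge K k = 1\<close> by simp
  qed
  then have fk: "k \<in> frontier K" using \<open>k \<in> K\<close> clo by (simp add: frontier_def)
  have "star_gauge K (inverse t *\<^sub>R x) = inverse t * u" using u by (simp add: star_gauge_scaleR[OF K] u_def)
  also have "\<dots> \<le> 1" using u by (simp add: field_simps)
  finally have inK: "inverse t *\<^sub>R x \<in> K" using mem by simp
  show ?thesis
  proof (rule ccontr)
    assume "inverse t *\<^sub>R x \<notin> interior K"
    then have ft: "inverse t *\<^sub>R x \<in> frontier K" using inK clo by (simp add: frontier_def)
    have "inverse t *\<^sub>R x = k"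
    proof -
      have "\<exists>!z. z \<in> {t *\<^sub>R x | t. t > 0} \<inter> frontier K"
        using K x unfolding star_body_def by blast
      moreover have "inverse t *\<^sub>R x \<in> {t *\<^sub>R x | t. t > 0} \<inter> frontier K" "k \<in> {t *\<^sub>R x | t. t > 0} \<inter> frontier K"
        using ft fk u unfolding k_def by auto
      ultimately show ?thesis by blast
    qed
    then show False using x u unfolding k_def by simp
  qed
qed

lemma interior_image_scaleR:
  fixes K :: "'a::euclidean_space set"
  assumes "c \<noteq> 0"
  shows "interior ((*\<^sub>R) c ` K) = (*\<^sub>R) c ` interior K"
  using assms by (intro interior_injective_linear_image) (auto simp: inj_on_def)

text \<open>Lower semicontinuity holds because dilates of \<open>K\<close> are closed, upper
  semicontinuity because dilates of the interior are open. The origin is treated later: continuity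
  there needs the linear upper bound, which in turn is derived from continuity on the unit
  sphere.\<close>

lemma tendsto_star_gauge_nonzero:
  assumes K: "star_body K" and x: "x \<noteq> 0"
  shows "(star_gauge K \<longlongrightarrow> star_gauge K x) (nhds x)"
proof (rule order_tendstoI)
  fix a assume a: "a < star_gauge K x"
  show "\<forall>\<^sub>F y in nhds x. a < star_gauge K y"
  proof (cases "a < 0")
    case True
    then show ?thesis using star_gauge_nonneg[OF K] by (intro always_eventually) (auto intro: less_le_trans)
  next
    case False
    have "closed K" using K compact_imp_closed unfolding star_body_def by blast
    then have "open (- ((\<lambda>z. a *\<^sub>R z) ` K))" using closed_scaling by (simp add: closed_def)
    moreover have *: "y \<in> - ((\<lambda>z. a *\<^sub>R z) ` K) \<longleftrightarrow> a < star_gauge K y" for y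
      using False star_gauge_le_iff[OF K, of a y] by auto
    ultimately show ?thesis using a unfolding eventually_nhds
      by (intro exI[of _ "- ((\<lambda>z. a *\<^sub>R z) ` K)"]) simp
  qed
next
  fix a assume "star_gauge K x < a"
  then obtain b where b: "star_gauge K x < b" "b < a" using dense by blast
  then have "0 < b" using star_gauge_nonneg[OF K, of x] by linarith
  have "x \<in> (*\<^sub>R) b ` interior K"
    using star_gauge_less_imp_interior[OF K x b(1)] \<open>0 < b\<close>
    by (intro image_eqI[of _ _ "inverse b *\<^sub>R x"]) auto
  moreover have "open ((*\<^sub>R) b ` interior K)"
    using interior_image_scaleR[of b K] \<open>0 < b\<close> by (metis less_irrefl open_interior)
  moreover have "star_gauge K y < a" if "y \<in> (*\<^sub>R) b ` interior K" for y
  proof -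
    have "y \<in> (*\<^sub>R) b ` K" using that interior_subset by blast
    then show ?thesis using star_gauge_le_iff[OF K, of b y] \<open>0 < b\<close> b by simp
  qed
  ultimately show "\<forall>\<^sub>F y in nhds x. star_gauge K y < a" unfolding eventually_nhds
    by (intro exI[of _ "(*\<^sub>R) b ` interior K"]) simp
qed

text \<open>By homogeneity both constants are extrema over the unit sphere. The minimum is positive
  since the gauge vanishes only at the origin.\<close>

lemma star_gauge_bounds:
  fixes K :: "'a::euclidean_space set"
  assumes K: "star_body K"
  obtains m M where "0 < m" "0 < M"
    "\<And>x. m * norm x \<le> star_gauge K x" "\<And>x. star_gauge K x \<le> M * norm x"
proof -
  have cont: "continuous_on (sphere 0 1) (star_gauge K)"
    unfolding continuous_on_def
  proof
    fix x :: 'a assume "x \<in> sphere 0 1"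
    then have "x \<noteq> 0" by auto
    show "(star_gauge K \<longlongrightarrow> star_gauge K x) (at x within sphere 0 1)"
      using tendsto_star_gauge_nonzero[OF K \<open>x \<noteq> 0\<close>]
      by (rule tendsto_mono[rotated]) (simp add: at_within_def)
  qed
  have ne: "sphere (0::'a) 1 \<noteq> {}" by simp
  obtain p where p: "p \<in> sphere 0 1" "\<And>y. y \<in> sphere 0 1 \<Longrightarrow> star_gauge K p \<le> star_gauge K y"
    using continuous_attains_inf[OF _ ne cont] by auto
  obtain q where q: "q \<in> sphere 0 1" "\<And>y. y \<in> sphere 0 1 \<Longrightarrow> star_gauge K y \<le> star_gauge K q"
    using continuous_attains_sup[OF _ ne cont] by auto
  have pos: "0 < star_gauge K y" if "y \<in> sphere 0 1" for y
    using that star_gauge_nonneg[OF K, of y] star_gauge_eq_zero_iff[OF K, of y] by force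
  have *: "star_gauge K x = norm x * star_gauge K (inverse (norm x) *\<^sub>R x)
      \<and> inverse (norm x) *\<^sub>R x \<in> sphere 0 1" if "x \<noteq> 0" for x
    using that by (simp add: star_gauge_scaleR[OF K])
  have z: "star_gauge K 0 = 0" using star_gauge_eq_zero_iff[OF K] by blast
  show ?thesis
  proof
    show "0 < star_gauge K p" "0 < star_gauge K q" using pos p q by auto
    fix x :: 'a
    show "star_gauge K p * norm x \<le> star_gauge K x"
      using *[of x] p(2)[of "inverse (norm x) *\<^sub>R x"] z
      by (cases "x = 0") (auto simp: mult.commute intro: mult_right_mono)
    show "star_gauge K x \<le> star_gauge K q * norm x"
      using *[of x] q(2)[of "inverse (norm x) *\<^sub>R x"] z
      by (cases "x = 0") (auto simp: mult.commute intro: mult_right_mono)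
  qed
qed

lemma continuous_on_star_gauge:
  fixes K :: "'a::euclidean_space set"
  assumes K: "star_body K"
  shows "continuous_on A (star_gauge K)"
proof (rule continuous_at_imp_continuous_on, rule ballI)
  fix x :: 'a
  show "isCont (star_gauge K) x"
  proof (cases "x = 0")
    case False
    show ?thesis unfolding isCont_def
      using tendsto_star_gauge_nonzero[OF K False]
      by (rule tendsto_mono[rotated]) (simp add: at_within_def)
  next
    case True
    obtain m M where M: "\<And>x. star_gauge K x \<le> M * norm x" using star_gauge_bounds[OF K] by metis
    have "((\<lambda>x::'a. M * norm x) \<longlongrightarrow> M * 0) (at 0)"
      by (rule tendsto_mult[OF tendsto_const tendsto_norm_zero[OF tendsto_ident_at]])
    then have "(star_gauge K \<longlongrightarrow> 0) (at 0)"
      by (intro tendsto_sandwich[of "\<lambda>_. 0" "star_gauge K" "at 0" "\<lambda>x. M * norm x"])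
        (auto simp: star_gauge_nonneg[OF K] M)
    then show ?thesis using True star_gauge_eq_zero_iff[OF K, of 0] by (simp add: isCont_def)
  qed
qed

lemma star_gauge_borel_measurable [measurable]:
  fixes K :: "'a::euclidean_space set"
  shows "star_body K \<Longrightarrow> star_gauge K \<in> borel_measurable borel"
  by (intro borel_measurable_continuous_onI continuous_on_star_gauge)

lemma star_body_image_scaleR:
  fixes K :: "'a::euclidean_space set"
  assumes K: "star_body K" and c: "0 < c"
  shows "star_body ((*\<^sub>R) c ` K)"
proof -
  have 1: "compact ((*\<^sub>R) c ` K)" using K compact_scaling unfolding star_body_def by blast
  have 2: "star_set ((*\<^sub>R) c ` K)"
    unfolding star_set_def
  proof safe
    fix k z assume k: "k \<in> K" and z: "z \<in> closed_segment 0 (c *\<^sub>R k)"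
    then obtain u where u: "0 \<le> u" "u \<le> 1" "z = u *\<^sub>R c *\<^sub>R k" by (auto simp: in_segment)
    then show "z \<in> (*\<^sub>R) c ` K" using star_body_shrink[OF K k, of u]
      by (intro image_eqI[of _ _ "u *\<^sub>R k"]) (auto simp: mult.commute)
  qed
  have int: "interior ((*\<^sub>R) c ` K) = (*\<^sub>R) c ` interior K" using c by (simp add: interior_image_scaleR)
  have fr: "frontier ((*\<^sub>R) c ` K) = (*\<^sub>R) c ` frontier K"
    unfolding frontier_def int using c
    by (subst closure_scaleR[symmetric], subst image_set_diff) (auto simp: inj_on_def)
  have 4: "\<exists>!z. z \<in> {t *\<^sub>R x | t. t > 0} \<inter> frontier ((*\<^sub>R) c ` K)" if "x \<noteq> 0" for x :: 'a
  proof -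
    have eq: "{t *\<^sub>R x | t. t > 0} \<inter> frontier ((*\<^sub>R) c ` K) = (*\<^sub>R) c ` ({t *\<^sub>R x | t. t > 0} \<inter> frontier K)"
    proof -
      have "{t *\<^sub>R x | t. t > 0} = (*\<^sub>R) c ` {t *\<^sub>R x | t. t > 0}"
      proof safe
        fix t :: real assume "t > 0"
        then show "t *\<^sub>R x \<in> (*\<^sub>R) c ` {t *\<^sub>R x | t. t > 0}"
          using c by (intro image_eqI[of _ _ "(t / c) *\<^sub>R x"]) (auto intro!: exI[of _ "t / c"])
      next
        fix t :: real assume "t > 0"
        then show "\<exists>u. c *\<^sub>R t *\<^sub>R x = u *\<^sub>R x \<and> 0 < u" using c by (intro exI[of _ "c * t"]) auto
      qed
      then show ?thesis unfolding fr using c by (subst image_Int) (auto simp: inj_on_def)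
    qed
    have "\<exists>!z. z \<in> {t *\<^sub>R x | t. t > 0} \<inter> frontier K" using K that unfolding star_body_def by blast
    then obtain z where "{t *\<^sub>R x | t. t > 0} \<inter> frontier K = {z}" by (rule ex1E) blast
    then show ?thesis unfolding eq by simp
  qed
  have "interior K \<noteq> {}" using K unfolding star_body_def by blast
  then have 3: "interior ((*\<^sub>R) c ` K) \<noteq> {}" unfolding int by simp
  show ?thesis unfolding star_body_def by (intro conjI allI impI 1 2 3 4)
qed

lemma emeasure_lborel_image_scaleR:
  fixes K :: "'a::euclidean_space set"
  assumes [measurable]: "K \<in> sets borel" and c: "0 < c"
  shows "emeasure lborel ((*\<^sub>R) c ` K) = ennreal (c ^ DIM('a)) * emeasure lborel K"
proof -
  have eq: "(*\<^sub>R) c ` K = (\<lambda>x. inverse c *\<^sub>R x) -` K"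
    using c by (auto simp: image_iff) (metis less_irrefl divideR_right scaleR_one)
  have m: "(\<lambda>x. inverse c *\<^sub>R x) -` K \<in> sets borel"
    using measurable_sets[of "\<lambda>x. inverse c *\<^sub>R x" borel borel K] by simp
  have "emeasure lborel ((*\<^sub>R) c ` K) = emeasure (density (distr lborel borel (\<lambda>x. 0 + c *\<^sub>R x)) (\<lambda>_. \<bar>c\<bar>^DIM('a))) ((*\<^sub>R) c ` K)"
    using c by (subst lborel_affine[of c 0]) auto
  also have "\<dots> = ennreal (c ^ DIM('a)) * emeasure lborel ((\<lambda>x. c *\<^sub>R x) -` (*\<^sub>R) c ` K)"
    using c m by (subst emeasure_density)
      (auto simp: eq nn_integral_cmult emeasure_distr ennreal_power)
  also have "(\<lambda>x. c *\<^sub>R x) -` (*\<^sub>R) c ` K = K"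
    using c by (auto simp: image_iff)
  finally show ?thesis .
qed

lemma star_body_emeasure:
  fixes K :: "'a::euclidean_space set"
  assumes K: "star_body K"
  shows "0 < emeasure lborel K" "emeasure lborel K < \<infinity>"
proof -
  have comp: "compact K" using K unfolding star_body_def by blast
  then show "emeasure lborel K < \<infinity>" by (rule emeasure_compact_finite)
  obtain x where "x \<in> interior K" using K unfolding star_body_def by blast
  then obtain e where e: "e > 0" "ball x e \<subseteq> K" using mem_interior by blast
  have "0 < emeasure lborel (ball x e)" using e
    using content_ball_pos[of e x] emeasure_eq_ennreal_measure[of lborel "ball x e"]
      emeasure_lborel_ball_finite[of x e] by (simp add: less_top)
  also have "\<dots> \<le> emeasure lborel K" using e comp by (intro emeasure_mono) (auto intro: compact_imp_closed borel_closed)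
  finally show "0 < emeasure lborel K" .
qed

section \<open>Lower semicontinuous functions and measurable selections\<close>

lemma lsc_iff_open_greater: "lsc f \<longleftrightarrow> (\<forall>a. open {x. a < f x})"
proof
  assume "lsc f"
  show "\<forall>a. open {x. a < f x}"
  proof
    fix a
    show "open {x. a < f x}"
    proof (subst open_subopen, safe)
      fix x assume "a < f x"
      then obtain S where "open S" "x \<in> S" "\<forall>y\<in>S. a < f y"
        using \<open>lsc f\<close> unfolding lsc_def eventually_nhds by blast
      then show "\<exists>T. open T \<and> x \<in> T \<and> T \<subseteq> {x. a < f x}" by (intro exI[of _ S]) auto
    qed
  qed
next
  assume *: "\<forall>a. open {x. a < f x}"
  show "lsc f" unfolding lsc_def eventually_nhds
  proof (intro allI impI)
    fix x a assume "a < f x"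
    then show "\<exists>S. open S \<and> x \<in> S \<and> (\<forall>y\<in>S. a < f y)"
      using * by (intro exI[of _ "{x. a < f x}"]) auto
  qed
qed

lemma lsc_closed_le:
  assumes "lsc f"
  shows "closed {x. f x \<le> a}"
proof -
  have "- {x. f x \<le> a} = {x. a < f x}" by auto
  then show ?thesis using assms unfolding lsc_iff_open_greater closed_def by simp
qed

lemma lsc_borel_measurable:
  assumes "lsc f"
  shows "f \<in> borel_measurable borel"
  using assms unfolding lsc_iff_open_greater
  by (intro borel_measurableI_greater) auto

lemma lsc_compose_continuous:
  assumes "lsc f" "continuous_on UNIV g"
  shows "lsc (\<lambda>x. f (g x))"
  unfolding lsc_iff_open_greater
proof
  fix a
  have "open (g -` {x. a < f x})"
    using assms unfolding lsc_iff_open_greater by (intro open_vimage) auto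
  then show "open {x. a < f (g x)}" by (simp add: vimage_def)
qed

lemma lsc_cmult_diff_continuous:
  fixes f g :: "'a::topological_space \<Rightarrow> real"
  assumes f: "lsc f" and g: "continuous_on UNIV g" and s: "0 \<le> s"
  shows "lsc (\<lambda>x. s * f x - g x)"
  unfolding lsc_def
proof (intro allI impI)
  fix x a assume a: "a < s * f x - g x"
  define d where "d = (s * f x - g x - a) / 2"
  have d: "d > 0" "s * f x - d - (g x + d) = a" using a unfolding d_def by (auto simp: field_simps)
  have "open {y. g y < g x + d}" by (intro open_Collect_less g continuous_intros)
  then have 1: "\<forall>\<^sub>F y in nhds x. g y < g x + d"
    using d unfolding eventually_nhds by (intro exI[of _ "{y. g y < g x + d}"]) auto
  have 2: "\<forall>\<^sub>F y in nhds x. s * f x - d < s * f y"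
  proof (cases "s = 0")
    case True
    then show ?thesis using d by simp
  next
    case False
    then have "0 < s" using s by simp
    then have "f x - d / s < f x" using d by simp
    then have "\<forall>\<^sub>F y in nhds x. f x - d / s < f y" using f unfolding lsc_def by blast
    then show ?thesis by eventually_elim (use \<open>0 < s\<close> in \<open>simp add: field_simps\<close>)
  qed
  show "\<forall>\<^sub>F y in nhds x. a < s * f y - g y"
    using 1 2 by eventually_elim (use d in linarith)
qed

text \<open>Without a minimizer the open sets \<open>{x. f y < f x}\<close> with \<open>y\<close> in
  \<open>S\<close> cover \<open>S\<close>. In a finite subcover the centre with the least value is
  not covered.\<close>

lemma lsc_attains_inf:
  fixes f :: "'a::topological_space \<Rightarrow> real"
  assumes "lsc f" "compact S" "S \<noteq> {}"
  shows "\<exists>x\<in>S. \<forall>y\<in>S. f x \<le> f y"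
proof (rule ccontr)
  assume neg: "\<not> ?thesis"
  have "S \<subseteq> (\<Union>y\<in>S. {x. f y < f x})"
  proof
    fix x assume "x \<in> S"
    then obtain y where "y \<in> S" "f y < f x" using neg by (meson not_le)
    then show "x \<in> (\<Union>y\<in>S. {x. f y < f x})" by auto
  qed
  then obtain D where D: "D \<subseteq> S" "finite D" "S \<subseteq> (\<Union>y\<in>D. {x. f y < f x})"
    using compactE_image[OF \<open>compact S\<close>, of S "\<lambda>y. {x. f y < f x}"] \<open>lsc f\<close>
    unfolding lsc_iff_open_greater by auto
  have "D \<noteq> {}" using D \<open>S \<noteq> {}\<close> by auto
  then have "Min (f ` D) \<in> f ` D" using D by (intro Min_in) auto
  then obtain y where y: "y \<in> D" "f y = Min (f ` D)" by auto
  then obtain z where "z \<in> D" "f z < f y" using D by blast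
  moreover have "f y \<le> f z" using y \<open>z \<in> D\<close> D by simp
  ultimately show False by simp
qed

text \<open>Kuratowski--Ryll-Nardzewski selection: intersecting \<open>F\<close> with balls of radius \<open>2\<^sup>-\<^sup>k\<close> around
  the points of a dense sequence, always the first one that is hit, shrinks \<open>F\<close> to a point.\<close>

lemma measurable_selection_compact:
  fixes F :: "'b \<Rightarrow> 'a::euclidean_space set"
  assumes comp: "\<And>x. x \<in> space M \<Longrightarrow> compact (F x)"
    and ne: "\<And>x. x \<in> space M \<Longrightarrow> F x \<noteq> {}"
    and meas: "\<And>L. closed L \<Longrightarrow> {x \<in> space M. F x \<inter> L \<noteq> {}} \<in> sets M"
  obtains T where "T \<in> borel_measurable M" "\<And>x. x \<in> space M \<Longrightarrow> T x \<in> F x"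
proof -
  obtain D :: "'a set" where D: "countable D" "\<And>X. open X \<Longrightarrow> X \<noteq> {} \<Longrightarrow> \<exists>d\<in>D. d \<in> X"
    using countable_dense_setE by blast
  have "D \<noteq> {}" using D(2)[of UNIV] by auto
  define d where "d = from_nat_into D"
  have d: "\<exists>j. dist (d j) y < r" if "r > 0" for y r
  proof -
    have "ball y r \<noteq> {}" using that by simp
    then obtain p where "p \<in> D" "p \<in> ball y r" using D(2)[OF open_ball] by blast
    then show ?thesis unfolding d_def using from_nat_into_surj[OF D(1)]
      by (metis dist_commute mem_ball)
  qed
  define U where "U k j = cball (d j) ((1/2)^k)" for k j
  define G where "G = rec_nat F (\<lambda>k H x. H x \<inter> U k (LEAST j. H x \<inter> U k j \<noteq> {}))"
  have G0: "G 0 = F" unfolding G_def by simp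
  have GS: "G (Suc k) x = G k x \<inter> U k (LEAST j. G k x \<inter> U k j \<noteq> {})" for k x
    unfolding G_def by simp
  have hit: "\<exists>j. S \<inter> U k j \<noteq> {}" if S: "S \<noteq> {}" for S k
  proof -
    obtain y where "y \<in> S" using S by blast
    obtain j where "dist (d j) y < (1/2)^k" using d[of "(1/2)^k" y] by auto
    then have "y \<in> U k j" unfolding U_def by simp
    then show ?thesis using \<open>y \<in> S\<close> by blast
  qed
  have Gc: "compact (G k x) \<and> G k x \<noteq> {}" if "x \<in> space M" for k x
  proof (induction k)
    case 0 then show ?case using comp ne that by (simp add: G0)
  next
    case (Suc k)
    have "G (Suc k) x \<noteq> {}" unfolding GS by (rule LeastI_ex[OF hit]) (use Suc in blast)
    moreover have "compact (G (Suc k) x)" unfolding GS U_def using Suc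
      by (intro compact_Int_closed) auto
    ultimately show ?case by simp
  qed
  have GU: "\<exists>j. G (Suc k) x \<subseteq> U k j" for k x unfolding GS by blast
  have Gm: "{x \<in> space M. G k x \<inter> L \<noteq> {}} \<in> sets M" if "closed L" for k L
    using that
  proof (induction k arbitrary: L)
    case 0 then show ?case using meas by (simp add: G0)
  next
    case (Suc k)
    have [measurable]: "Measurable.pred M (\<lambda>x. G k x \<inter> U k j \<noteq> {})" for j
      using Suc.IH[of "U k j"] unfolding pred_def U_def by simp
    have [measurable]: "Measurable.pred M (\<lambda>x. G k x \<inter> (U k j \<inter> L) \<noteq> {})" for j
      using Suc.IH[of "U k j \<inter> L"] Suc.prems unfolding pred_def U_def by (simp add: closed_Int)
    \<comment> \<open>Splitting according to the first ball hit expresses the condition for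
      \<open>Suc k\<close> through countably many conditions on how \<open>G k x\<close> meets
      closed sets.\<close>
    have eq: "G (Suc k) x \<inter> L \<noteq> {} \<longleftrightarrow>
       (\<exists>j. (G k x \<inter> U k j \<noteq> {} \<and> (\<forall>i\<in>{..<j}. \<not> G k x \<inter> U k i \<noteq> {})) \<and> G k x \<inter> (U k j \<inter> L) \<noteq> {})"
      if "x \<in> space M" for x
    proof -
      define l where "l = (LEAST j. G k x \<inter> U k j \<noteq> {})"
      have "(G k x \<inter> U k j \<noteq> {} \<and> (\<forall>i\<in>{..<j}. \<not> G k x \<inter> U k i \<noteq> {})) \<longleftrightarrow> j = l" for j
      proof -
        have a: "G k x \<inter> U k l \<noteq> {}" unfolding l_def
          by (rule LeastI_ex[OF hit]) (use Gc[OF that] in blast)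
        have b: "\<not> G k x \<inter> U k i \<noteq> {}" if "i < l" for i
          using not_less_Least[OF that[unfolded l_def]] .
        show ?thesis using a b by (metis lessThan_iff linorder_neqE_nat)
      qed
      then show ?thesis unfolding GS l_def[symmetric] by (simp add: Int_assoc)
    qed
    have "Measurable.pred M (\<lambda>x. \<exists>j. (G k x \<inter> U k j \<noteq> {} \<and> (\<forall>i\<in>{..<j}. \<not> G k x \<inter> U k i \<noteq> {})) \<and> G k x \<inter> (U k j \<inter> L) \<noteq> {})"
      by measurable
    then show ?case unfolding pred_def using eq by (simp cong: conj_cong)
  qed
  have Gmono: "G (Suc k) x \<subseteq> G k x" for k x unfolding GS by blast
  have Ganti: "G n x \<subseteq> G m x" if "m \<le> n" for m n x
    using that by (induction rule: dec_induct) (use Gmono in blast)+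
  define T where "T x = (SOME y. \<forall>k. y \<in> G k x)" for x
  have nest: "\<exists>y. \<forall>k. y \<in> G k x \<inter> L" if "x \<in> space M" "closed L" "\<And>k. G k x \<inter> L \<noteq> {}" for x L
  proof -
    have "\<Inter>(range (\<lambda>k. G k x \<inter> L)) \<noteq> {}"
      using that Gc by (intro compact_nest Int_mono Ganti order_refl) (auto intro: compact_Int_closed)
    then show ?thesis by blast
  qed
  have T: "\<forall>k. T x \<in> G k x" if "x \<in> space M" for x
  proof -
    have "\<exists>y. \<forall>k. y \<in> G k x" using nest[OF that, of UNIV] Gc[OF that] by auto
    then show ?thesis unfolding T_def by (rule someI_ex)
  qed
  have uniq: "y = z" if "\<And>k. y \<in> G k x" "\<And>k. z \<in> G k x" for x y z
  proof (rule ccontr)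
    assume "y \<noteq> z"
    then have "0 < dist y z / 2" by simp
    then obtain k where k: "(1/2::real)^k < dist y z / 2"
      using real_arch_pow_inv[of "dist y z / 2" "1/2"] by auto
    obtain j where "G (Suc k) x \<subseteq> U k j" using GU by blast
    then have "y \<in> U k j" "z \<in> U k j" using that by blast+
    then have "dist (d j) y \<le> (1/2)^k" "dist (d j) z \<le> (1/2)^k" unfolding U_def by auto
    then show False using k dist_triangle3[of y z "d j"] by linarith
  qed
  have "T \<in> borel_measurable M"
  proof (rule borel_measurableI)
    fix S :: "'a set" assume "open S"
    define L where "L = - S"
    have "closed L" using \<open>open S\<close> unfolding L_def closed_def by simp
    \<comment> \<open>The sets \<open>G k x\<close> shrink to the single point \<open>T x\<close>.
      If all of them meet the closed set \<open>L\<close>, then by compactness they have a common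
      point in \<open>L\<close>, and it must be \<open>T x\<close>.\<close>
    have "T -` L \<inter> space M = (\<Inter>k. {x \<in> space M. G k x \<inter> L \<noteq> {}})"
    proof (intro equalityI subsetI)
      fix x assume "x \<in> T -` L \<inter> space M"
      then show "x \<in> (\<Inter>k. {x \<in> space M. G k x \<inter> L \<noteq> {}})" using T[of x] by blast
    next
      fix x assume x: "x \<in> (\<Inter>k. {x \<in> space M. G k x \<inter> L \<noteq> {}})"
      then have "x \<in> space M" by blast
      then obtain y where "\<forall>k. y \<in> G k x \<inter> L" using nest[of x L] x \<open>closed L\<close> by auto
      moreover from this have "y = T x" using uniq T[OF \<open>x \<in> space M\<close>] by blast
      ultimately show "x \<in> T -` L \<inter> space M" using \<open>x \<in> space M\<close> by blast
    qed
    then have "T -` L \<inter> space M \<in> sets M" using Gm[OF \<open>closed L\<close>] by auto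
    moreover have "T -` S \<inter> space M = space M - (T -` L \<inter> space M)" unfolding L_def by auto
    ultimately show "T -` S \<inter> space M \<in> sets M" by simp
  qed
  moreover have "T x \<in> F x" if "x \<in> space M" for x
    using T[OF that] G0 by metis
  ultimately show ?thesis using that by blast
qed

text \<open>The set \<open>F x\<close> of minimizers meets \<open>L\<close> iff the minimum over
  \<open>B \<inter> L\<close> equals the minimum over \<open>B\<close>, which can be tested with
  rational thresholds. For each threshold the relevant set of \<open>x\<close> is a closed set
  projected along a compact factor, hence closed.\<close>

lemma lsc_argmin_selector:
  fixes h :: "'a::euclidean_space \<times> 'b::euclidean_space \<Rightarrow> real"
  assumes h: "lsc h" and B: "compact B" "B \<noteq> {}"
  obtains T where "T \<in> borel_measurable borel" "\<And>x. T x \<in> B" "\<And>x y. y \<in> B \<Longrightarrow> h (x, T x) \<le> h (x, y)"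
proof -
  have lsc_sec: "lsc (\<lambda>y. h (x, y))" for x
    by (intro lsc_compose_continuous[OF h] continuous_intros)
  define F where "F x = B \<inter> {y. \<forall>z\<in>B. h (x, y) \<le> h (x, z)}" for x
  have Fne: "F x \<noteq> {}" for x
    using lsc_attains_inf[OF lsc_sec B] unfolding F_def by blast
  have Fc: "compact (F x)" for x
  proof -
    have "F x = B \<inter> (\<Inter>z\<in>B. {y. h (x, y) \<le> h (x, z)})" unfolding F_def by auto
    then show ?thesis using lsc_closed_le[OF lsc_sec] B by (auto intro!: compact_Int_closed closed_INT)
  qed
  have proj: "closed {x. \<exists>y\<in>S. h (x, y) \<le> q}" if "compact S" for S q
  proof -
    have "closed (prod.swap -` {z. h z \<le> q})"
      by (intro closed_vimage lsc_closed_le h continuous_on_swap)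
    from closed_compact_projection[OF that this] show ?thesis
      by (simp add: Bex_def prod.swap_def)
  qed
  have Fm: "{x. F x \<inter> L \<noteq> {}} \<in> sets borel" if "closed L" for L
  proof -
    have c: "compact (B \<inter> L)" using B that by (intro compact_Int_closed)
    have [measurable]: "{x. \<exists>y\<in>B. h (x, y) \<le> q} \<in> sets borel"
       "{x. \<exists>y\<in>B \<inter> L. h (x, y) \<le> q} \<in> sets borel" for q
      using proj[OF B(1)] proj[OF c] by auto
    have "F x \<inter> L \<noteq> {} \<longleftrightarrow> (\<forall>q\<in>\<rat>. (\<exists>y\<in>B. h (x, y) \<le> q) \<longrightarrow> (\<exists>y\<in>B \<inter> L. h (x, y) \<le> q))" for x
    proof
      assume "F x \<inter> L \<noteq> {}"
      then obtain y where "y \<in> B \<inter> L" "\<forall>z\<in>B. h (x, y) \<le> h (x, z)" unfolding F_def by blast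
      then show "\<forall>q\<in>\<rat>. (\<exists>y\<in>B. h (x, y) \<le> q) \<longrightarrow> (\<exists>y\<in>B \<inter> L. h (x, y) \<le> q)"
        by (meson order_trans)
    next
      assume *: "\<forall>q\<in>\<rat>. (\<exists>y\<in>B. h (x, y) \<le> q) \<longrightarrow> (\<exists>y\<in>B \<inter> L. h (x, y) \<le> q)"
      obtain z where z: "z \<in> B" "\<forall>y\<in>B. h (x, z) \<le> h (x, y)"
        using lsc_attains_inf[OF lsc_sec B] by blast
      \<comment> \<open>A threshold above the minimum over \<open>B\<close> shows that
        \<open>B \<inter> L\<close> is nonempty, so a minimizer on it exists.\<close>
      obtain q0 where "q0 \<in> \<rat>" "h (x, z) < q0"
        using Rats_dense_in_real[of "h (x, z)" "h (x, z) + 1"] by auto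
      then have "\<exists>y\<in>B \<inter> L. h (x, y) \<le> q0" using * z(1) less_imp_le by blast
      then have "B \<inter> L \<noteq> {}" by blast
      then obtain w where w: "w \<in> B \<inter> L" "\<forall>y\<in>B \<inter> L. h (x, w) \<le> h (x, y)"
        using lsc_attains_inf[OF lsc_sec c] by blast
      have "h (x, w) \<le> h (x, z)"
      proof (rule ccontr)
        assume "\<not> ?thesis"
        then obtain q where "q \<in> \<rat>" "h (x, z) < q" "q < h (x, w)"
          using Rats_dense_in_real[of "h (x, z)" "h (x, w)"] by auto
        then show False using * z w by (meson less_imp_le not_le order_trans)
      qed
      then have "w \<in> F x" using w z unfolding F_def by (auto intro: order_trans)
      then show "F x \<inter> L \<noteq> {}" using w by blast
    qed
    then have "{x. F x \<inter> L \<noteq> {}} =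
      {x. \<forall>q\<in>\<rat>. x \<in> {x. \<exists>y\<in>B. h (x, y) \<le> q} \<longrightarrow> x \<in> {x. \<exists>y\<in>B \<inter> L. h (x, y) \<le> q}}" by simp
    also have "\<dots> = (\<Inter>q\<in>\<rat>. - {x. \<exists>y\<in>B. h (x, y) \<le> q} \<union> {x. \<exists>y\<in>B \<inter> L. h (x, y) \<le> q})" by auto
    also have "\<dots> \<in> sets borel"
      by (intro sets.countable_INT' sets.Un borel_comp countable_rat) (auto intro!: Rats_0)
    finally show ?thesis .
  qed
  obtain T where "T \<in> borel_measurable borel" "\<And>x. x \<in> space borel \<Longrightarrow> T x \<in> F x"
    using measurable_selection_compact[of borel F] Fc Fne Fm by auto
  then show ?thesis using that[of T] unfolding F_def by simp
qed

section \<open>Duality for a fixed body\<close>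

text \<open>\<open>real_of_ereal\<close> sends \<infinity> to 0, which does not change the integral
  because an integrable \<open>l\<close> is finite almost everywhere.\<close>

lemma L1_nonneg_integral:
  assumes l: "l \<in> L1 P" and nonneg: "\<And>x. 0 \<le> l x"
  shows "ereal (LINT x|P. real_of_ereal (l x)) = enn2ereal (\<integral>\<^sup>+ x. e2ennreal (l x) \<partial>P)"
    and "(\<integral>\<^sup>+ x. e2ennreal (l x) \<partial>P) < \<infinity>"
proof -
  have [measurable]: "l \<in> borel_measurable P" using l unfolding L1_def by blast
  show fin: "(\<integral>\<^sup>+ x. e2ennreal (l x) \<partial>P) < \<infinity>"
    using l nonneg unfolding L1_def by simp
  then have "AE x in P. e2ennreal (l x) \<noteq> \<infinity>" by (intro nn_integral_PInf_AE) auto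
  moreover have "real_of_ereal (l x) = enn2real (e2ennreal (l x))" for x
    using nonneg[of x] unfolding enn2real_def by (simp add: enn2ereal_e2ennreal)
  ultimately have "AE x in P. ennreal (real_of_ereal (l x)) = e2ennreal (l x)"
    by (auto simp: less_top)
  then have "(\<integral>\<^sup>+ x. ennreal (real_of_ereal (l x)) \<partial>P) = (\<integral>\<^sup>+ x. e2ennreal (l x) \<partial>P)"
    by (rule nn_integral_cong_AE)
  moreover have "(LINT x|P. real_of_ereal (l x)) = enn2real (\<integral>\<^sup>+ x. ennreal (real_of_ereal (l x)) \<partial>P)"
    by (intro integral_eq_nn_integral) (auto simp: nonneg real_of_ereal_pos)
  ultimately show "ereal (LINT x|P. real_of_ereal (l x)) = enn2ereal (\<integral>\<^sup>+ x. e2ennreal (l x) \<partial>P)"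
    using fin by (cases "\<integral>\<^sup>+ x. e2ennreal (l x) \<partial>P") auto
qed

text \<open>The slope of a line through \<open>(\<epsilon>, V)\<close> that supports \<open>D\<close> from above: the least slope of the
  chords from points of \<open>D\<close> on the left.\<close>

lemma supporting_slope:
  fixes D :: "(real \<times> real) set"
  assumes conv: "\<And>c e c' e' p. (c, e) \<in> D \<Longrightarrow> (c', e') \<in> D \<Longrightarrow> 0 \<le> p \<Longrightarrow> p \<le> 1 \<Longrightarrow>
       (p * c + (1 - p) * c', p * e + (1 - p) * e') \<in> D"
    and base: "(c0, e0) \<in> D" "c0 < \<epsilon>"
    and bound: "\<And>c e. (c, e) \<in> D \<Longrightarrow> c \<le> \<epsilon> \<Longrightarrow> e \<le> V"
  obtains s where "0 \<le> s" "\<And>c e. (c, e) \<in> D \<Longrightarrow> e \<le> V + s * (c - \<epsilon>)"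
proof -
  define B where "B = {(V - e) / (\<epsilon> - c) | c e. (c, e) \<in> D \<and> c < \<epsilon>}"
  have ne: "B \<noteq> {}" using base unfolding B_def by blast
  have nonneg: "0 \<le> b" if "b \<in> B" for b
    using that bound unfolding B_def by fastforce
  then have bdd: "bdd_below B" by (rule bdd_belowI)
  show ?thesis
  proof (rule that[of "Inf B"])
    show "0 \<le> Inf B" using ne nonneg by (rule cInf_greatest)
    fix c e assume D: "(c, e) \<in> D"
    consider "c < \<epsilon>" | "c = \<epsilon>" | "c > \<epsilon>" by linarith
    then show "e \<le> V + Inf B * (c - \<epsilon>)"
    proof cases
      case 1
      then have "(V - e) / (\<epsilon> - c) \<in> B" using D unfolding B_def by blast
      then have "Inf B \<le> (V - e) / (\<epsilon> - c)" using bdd by (rule cInf_lower)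
      then have "Inf B * (\<epsilon> - c) \<le> V - e" using 1 by (simp add: pos_le_divide_eq)
      then show ?thesis by (simp add: algebra_simps)
    next
      case 2
      then show ?thesis using bound[OF D] by simp
    next
      case 3
      have "(e - V) / (c - \<epsilon>) \<le> b" if "b \<in> B" for b
      proof -
        from that obtain c1 e1 where b: "b = (V - e1) / (\<epsilon> - c1)" "(c1, e1) \<in> D" "c1 < \<epsilon>"
          unfolding B_def by blast
        \<comment> \<open>The weight for which the mixture of \<open>(c1, e1)\<close> and
          \<open>(c, e)\<close> has first coordinate exactly \<open>\<epsilon>\<close>.\<close>
        define p where "p = (c - \<epsilon>) / (c - c1)"
        have p: "0 \<le> p" "p \<le> 1" "p * (c - c1) = c - \<epsilon>" using 3 b unfolding p_def by auto
        have "p * c1 + (1 - p) * c = \<epsilon>" using p(3) by (simp add: algebra_simps)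
        then have "p * e1 + (1 - p) * e \<le> V"
          using bound conv[OF b(2) D p(1,2)] by (metis order_refl)
        then have "(p * e1 + (1 - p) * e) * (c - c1) \<le> V * (c - c1)"
          using 3 b by (intro mult_right_mono) auto
        also have "(p * e1 + (1 - p) * e) * (c - c1) = p * (c - c1) * e1 + ((c - c1) - p * (c - c1)) * e"
          by (simp add: algebra_simps)
        finally have "(c - \<epsilon>) * e1 + (\<epsilon> - c1) * e \<le> V * (c - c1)" unfolding p(3) by simp
        then have "(e - V) * (\<epsilon> - c1) \<le> (V - e1) * (c - \<epsilon>)" by (simp add: algebra_simps)
        then show ?thesis unfolding b(1) using 3 b(3) by (simp add: divide_simps mult.commute)
      qed
      then have "(e - V) / (c - \<epsilon>) \<le> Inf B" using ne by (intro cInf_greatest) auto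
      then show ?thesis using 3 by (simp add: pos_divide_le_eq algebra_simps)
    qed
  qed
qed

lemma argmin_set_iff: "x \<in> argmin_set f S \<longleftrightarrow> x \<in> S \<and> (\<forall>y\<in>S. f x \<le> f y) \<and> f x < \<infinity>"
  unfolding argmin_set_def is_arg_min_def by (auto simp: not_less)

section \<open>The transport setting and the c-transform\<close>

locale transport_ambiguity =
  fixes P :: "'a::euclidean_space measure" and C :: "'a \<times> 'a \<Rightarrow> real"
  assumes distribution: "distribution P"
    and integrable_norm: "integrable P (\<lambda>x. norm x)"
    and C_nonneg: "0 \<le> C z"
    and C_lsc: "lsc C"
    and C_zero_iff: "C (x, y) = 0 \<longleftrightarrow> x = y"
begin

sublocale prob_space P
  using distribution unfolding distribution_def by blast

lemma sets_P [measurable_cong]: "sets P = sets borel"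
  using distribution unfolding distribution_def by blast

lemma space_P [simp]: "space P = UNIV"
  using sets_eq_imp_space_eq[OF sets_P] by simp

lemma C_borel_measurable [measurable]: "C \<in> borel_measurable borel"
  by (rule lsc_borel_measurable[OF C_lsc])

lemma C_section_borel_measurable [measurable (raw)]:
  assumes "f \<in> borel_measurable M" "g \<in> borel_measurable M"
  shows "(\<lambda>x. C (f x, g x)) \<in> borel_measurable M"
  using measurable_compose[OF borel_measurable_Pair[OF assms] C_borel_measurable] .

lemma C_refl [simp]: "C (x, x) = 0"
  using C_zero_iff by blast

text \<open>This is the c-transform of optimal transport. Truncating negative values at 0 is
  harmless for \<open>g >= 0\<close>, because the choice \<open>y = x\<close> already contributes
  \<open>g x\<close>.\<close>

definition c_transform :: "('a \<Rightarrow> real) \<Rightarrow> real \<Rightarrow> 'a \<Rightarrow> ennreal" where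
  "c_transform g s x = (SUP y. ennreal (g y - s * C (x, y)))"

lemma c_transform_ge: "ennreal (g y - s * C (x, y)) \<le> c_transform g s x"
  unfolding c_transform_def by (rule SUP_upper) simp

lemma c_transform_ge_self: "ennreal (g x) \<le> c_transform g s x"
  using c_transform_ge[of g x s x] by simp

text \<open>\<open>T n\<close> maximizes over the ball of radius \<open>n\<close> and leaves points
  outside the ball where they are, at no cost. Hence it never does worse than staying put,
  displacements grow at most linearly, and the balls exhaust all targets.\<close>

lemma c_transform_selectors:
  fixes g :: "'a \<Rightarrow> real"
  assumes g: "continuous_on UNIV g" and s: "0 \<le> s"
  shows "\<exists>T :: nat \<Rightarrow> 'a \<Rightarrow> 'a.
    (\<forall>n. T n \<in> borel_measurable borel) \<and>
    (\<forall>n x. norm (T n x) \<le> real n + norm x) \<and>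
    (\<forall>n x. g x \<le> g (T n x) - s * C (x, T n x)) \<and>
    (\<forall>x. incseq (\<lambda>n. ennreal (g (T n x) - s * C (x, T n x)))) \<and>
    (\<forall>x. c_transform g s x = (SUP n. ennreal (g (T n x) - s * C (x, T n x))))"
proof -
  \<comment> \<open>With the sign reversed, maximizing the gain becomes minimizing a lower
    semicontinuous function.\<close>
  define h where "h z = s * C z - g (snd z)" for z
  have h: "lsc h" unfolding h_def
    by (intro lsc_cmult_diff_continuous C_lsc s continuous_on_compose2[OF g]) (auto intro: continuous_on_snd)
  have "\<exists>S. S \<in> borel_measurable borel \<and> (\<forall>x. S x \<in> cball 0 (real n)) \<and>
     (\<forall>x. \<forall>y\<in>cball 0 (real n). h (x, S x) \<le> h (x, y))" for n
    by (rule lsc_argmin_selector[OF h, of "cball 0 (real n)"]) auto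
  then obtain S where S: "\<And>n. S n \<in> borel_measurable borel" "\<And>n x. S n x \<in> cball 0 (real n)"
     "\<And>n x y. y \<in> cball 0 (real n) \<Longrightarrow> h (x, S n x) \<le> h (x, y)"
    by metis
  note [measurable] = S(1)
  define T where "T n x = (if norm x \<le> real n then S n x else x)" for n x
  have opt: "g y - s * C (x, y) \<le> g (T n x) - s * C (x, T n x)"
    if "norm x \<le> real n" "norm y \<le> real n" for n x y
    using S(3)[of y n x] that unfolding T_def h_def by auto
  have out: "T n x = x" if "real n < norm x" for n x using that unfolding T_def by auto
  have bnd: "norm (T n x) \<le> real n" if "norm x \<le> real n" for n x
    using S(2)[of n x] that unfolding T_def by auto
  have ge: "g x \<le> g (T n x) - s * C (x, T n x)" for n x
    using opt[of x n x] out[of n x] by (cases "norm x \<le> real n") auto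
  have step: "g (T n x) - s * C (x, T n x) \<le> g (T (Suc n) x) - s * C (x, T (Suc n) x)" for n x
    using opt[of x "Suc n" "T n x"] bnd[of x n] out[of n x] ge[of x "Suc n"]
    by (cases "norm x \<le> real n") auto
  show ?thesis
  proof (intro exI[of _ T] conjI allI)
    show "T n \<in> borel_measurable borel" for n unfolding T_def by measurable
    show "norm (T n x) \<le> real n + norm x" for n x
      using bnd[of x n] out[of n x] by (cases "norm x \<le> real n") (auto intro: add_increasing2)
    show "g x \<le> g (T n x) - s * C (x, T n x)" for n x by (rule ge)
    show "incseq (\<lambda>n. ennreal (g (T n x) - s * C (x, T n x)))" for x
      by (intro incseq_SucI ennreal_leI step)
    show "c_transform g s x = (SUP n. ennreal (g (T n x) - s * C (x, T n x)))" for x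
    proof (rule antisym)
      show "c_transform g s x \<le> (SUP n. ennreal (g (T n x) - s * C (x, T n x)))"
        unfolding c_transform_def
      proof (rule SUP_least)
        fix y :: 'a
        obtain n where "max (norm x) (norm y) \<le> real n" using real_arch_simple by blast
        then show "ennreal (g y - s * C (x, y)) \<le> (SUP n. ennreal (g (T n x) - s * C (x, T n x)))"
          using opt[of x n y] by (intro SUP_upper2[of n] ennreal_leI) auto
      qed
      show "(SUP n. ennreal (g (T n x) - s * C (x, T n x))) \<le> c_transform g s x"
        by (intro SUP_least c_transform_ge)
    qed
  qed
qed

lemma c_transform_borel_measurable:
  assumes g: "continuous_on UNIV g" and s: "0 \<le> s"
  shows "c_transform g s \<in> borel_measurable borel"
proof -
  have [measurable]: "g \<in> borel_measurable borel" using g by (rule borel_measurable_continuous_onI)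
  obtain T :: "nat \<Rightarrow> 'a \<Rightarrow> 'a" where [measurable]: "\<And>n. T n \<in> borel_measurable borel"
    and eq: "\<And>x. c_transform g s x = (SUP n. ennreal (g (T n x) - s * C (x, T n x)))"
    using c_transform_selectors[OF g s] by blast
  have "(\<lambda>x. SUP n. ennreal (g (T n x) - s * C (x, T n x))) \<in> borel_measurable borel"
    by measurable
  then show ?thesis unfolding eq[abs_def] by simp
qed

section \<open>Feasible multipliers and weak duality\<close>

definition worst_gauge :: "real \<Rightarrow> 'a set \<Rightarrow> ennreal" where
  "worst_gauge \<epsilon> K = (SUP Q\<in>ambiguity_ball C \<epsilon> P. \<integral>\<^sup>+ x. ennreal (star_gauge K x) \<partial>Q)"

lemma A_objective_eq: "A_objective C \<epsilon> P K = enn2ereal (worst_gauge \<epsilon> K)"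
  unfolding A_objective_def worst_gauge_def ..

text \<open>On the diagonal the cost vanishes, so the constraint with \<open>y = x\<close> reads
  \<open>l x >= g x\<close>. This includes \<open>s = \<infinity>\<close>, since
  \<open>\<infinity> * 0 = 0\<close>.\<close>

lemma B_feasible_nonneg:
  assumes "(K, s, l) \<in> B_feasible S C P"
  shows "ereal (star_gauge K x) \<le> l x" "0 \<le> l x"
proof -
  have "star_body K" and "\<forall>x y. s * ereal (C (x, y)) + l x \<ge> ereal (star_gauge K y)"
    using assms unfolding B_feasible_def by auto
  from this(2)[rule_format, of x x] show "ereal (star_gauge K x) \<le> l x" by (simp flip: zero_ereal_def)
  then show "0 \<le> l x" using star_gauge_nonneg[OF \<open>star_body K\<close>, of x]
    by (metis ereal_less_eq(5) order_trans)
qed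

lemma B_objective_eq:
  assumes l: "l \<in> L1 P" "\<And>x. 0 \<le> l x" and s: "0 \<le> s" and e: "0 \<le> \<epsilon>"
  shows "B_objective \<epsilon> P (K, ereal s, l) = enn2ereal (ennreal (s * \<epsilon>) + (\<integral>\<^sup>+ x. e2ennreal (l x) \<partial>P))"
proof -
  have "B_objective \<epsilon> P (K, ereal s, l) = ereal (s * \<epsilon>) + ereal (LINT x|P. real_of_ereal (l x))"
    by (simp add: B_objective_def)
  also have "\<dots> = ereal (s * \<epsilon>) + enn2ereal (\<integral>\<^sup>+ x. e2ennreal (l x) \<partial>P)"
    by (simp only: L1_nonneg_integral(1)[OF l])
  also have "\<dots> = enn2ereal (ennreal (s * \<epsilon>) + (\<integral>\<^sup>+ x. e2ennreal (l x) \<partial>P))"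
    using s e by (simp add: plus_ennreal.rep_eq enn2ereal_ennreal)
  finally show ?thesis .
qed

text \<open>The transform may be infinite at some points even when its integral is finite, so the
  multiplier is kept extended-real valued.\<close>

lemma dual_point_of_c_transform:
  assumes K: "star_body K" "emeasure lborel K \<le> 1" and s: "0 \<le> s" and e: "0 \<le> \<epsilon>"
    and fin: "(\<integral>\<^sup>+ x. c_transform (star_gauge K) s x \<partial>P) < \<infinity>"
  defines "l \<equiv> (\<lambda>x. enn2ereal (c_transform (star_gauge K) s x))"
  shows "(K, ereal s, l) \<in> B_feasible {0..<\<infinity>} C P"
    and "B_objective \<epsilon> P (K, ereal s, l) = enn2ereal (ennreal (s * \<epsilon>) + (\<integral>\<^sup>+ x. c_transform (star_gauge K) s x \<partial>P))"
proof -
  have [measurable]: "c_transform (star_gauge K) s \<in> borel_measurable borel"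
    by (intro c_transform_borel_measurable continuous_on_star_gauge K s)
  have "l \<in> borel_measurable P" unfolding l_def by measurable
  then have l: "l \<in> L1 P" unfolding L1_def using fin by (simp add: l_def)
  have "ereal (star_gauge K y) \<le> ereal s * ereal (C (x, y)) + l x" for x y
  proof (cases "c_transform (star_gauge K) s x")
    case (real r)
    then show ?thesis using c_transform_ge[of "star_gauge K" y s x]
      by (simp add: l_def enn2ereal_ennreal)
  next
    case top
    then show ?thesis by (simp add: l_def)
  qed
  then show "(K, ereal s, l) \<in> B_feasible {0..<\<infinity>} C P"
    unfolding B_feasible_def using K s l by auto
  show "B_objective \<epsilon> P (K, ereal s, l) = enn2ereal (ennreal (s * \<epsilon>) + (\<integral>\<^sup>+ x. c_transform (star_gauge K) s x \<partial>P))"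
    by (subst B_objective_eq[OF l _ s e]) (simp_all add: l_def)
qed

text \<open>The transform is the pointwise least multiplier for given \<open>K\<close> and
  \<open>s\<close>.\<close>

lemma c_transform_le_feasible:
  assumes "(K, ereal s, l) \<in> B_feasible S C P"
  shows "c_transform (star_gauge K) s x \<le> e2ennreal (l x)"
  unfolding c_transform_def
proof (rule SUP_least)
  fix y
  have "ereal (star_gauge K y) \<le> ereal s * ereal (C (x, y)) + l x"
    using assms unfolding B_feasible_def by auto
  then have "ereal (star_gauge K y - s * C (x, y)) \<le> l x"
    by (cases "l x") auto
  then have "e2ennreal (ereal (star_gauge K y - s * C (x, y))) \<le> e2ennreal (l x)" by (rule e2ennreal_mono)
  then show "ennreal (star_gauge K y - s * C (x, y)) \<le> e2ennreal (l x)" by (simp add: ennreal_def)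
qed

lemma nn_integral_fst_coupling:
  assumes "distribution \<beta>" "distr \<beta> borel fst = P" "f \<in> borel_measurable borel"
  shows "(\<integral>\<^sup>+ z. f (fst z) \<partial>\<beta>) = (\<integral>\<^sup>+ x. f x \<partial>P)"
proof -
  have [measurable_cong]: "sets \<beta> = sets borel" using assms unfolding distribution_def by blast
  have "fst \<in> \<beta> \<rightarrow>\<^sub>M (borel :: 'a measure)"
    by (subst measurable_cong_sets[OF \<open>sets \<beta> = sets borel\<close> refl]) (intro borel_measurable_continuous_onI continuous_on_fst continuous_on_id)
  from nn_integral_distr[OF this, of f] assms show ?thesis by simp
qed

lemma nn_integral_snd_coupling:
  fixes \<beta> :: "('a \<times> 'a) measure"
  assumes "distribution \<beta>" "distr \<beta> borel snd = Q" "f \<in> borel_measurable borel"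
  shows "(\<integral>\<^sup>+ z. f (snd z) \<partial>\<beta>) = (\<integral>\<^sup>+ x. f x \<partial>Q)"
proof -
  have [measurable_cong]: "sets \<beta> = sets borel" using assms unfolding distribution_def by blast
  have "snd \<in> \<beta> \<rightarrow>\<^sub>M (borel :: 'a measure)"
    by (subst measurable_cong_sets[OF \<open>sets \<beta> = sets borel\<close> refl]) (intro borel_measurable_continuous_onI continuous_on_snd continuous_on_id)
  then show ?thesis unfolding assms(2)[symmetric]
    by (rule nn_integral_distr[symmetric]) (use assms(3) in simp)
qed

text \<open>Integrate the constraint against a coupling: the cost term is controlled by the radius,
  and \<open>l\<close> depends only on the first coordinate, whose law is \<open>P\<close>. The
  infimum over couplings need not be attained, hence the slack \<open>d\<close>.\<close>

lemma weak_duality: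
  assumes z: "(K, ereal s, l) \<in> B_feasible S C P" and s: "0 \<le> s" and e: "0 \<le> \<epsilon>"
  shows "worst_gauge \<epsilon> K \<le> ennreal (s * \<epsilon>) + (\<integral>\<^sup>+ x. e2ennreal (l x) \<partial>P)"
  unfolding worst_gauge_def
proof (rule SUP_least)
  fix Q assume Q: "Q \<in> ambiguity_ball C \<epsilon> P"
  have K: "star_body K" and l: "l \<in> L1 P"
    using z unfolding B_feasible_def by auto
  note [measurable] = star_gauge_borel_measurable[OF K]
  have [measurable]: "l \<in> borel_measurable borel"
    using l unfolding L1_def by (simp add: measurable_cong_sets[OF sets_P refl])
  have lm: "(\<lambda>x. e2ennreal (l x)) \<in> borel_measurable borel" by measurable
  show "(\<integral>\<^sup>+ x. ennreal (star_gauge K x) \<partial>Q) \<le> ennreal (s * \<epsilon>) + (\<integral>\<^sup>+ x. e2ennreal (l x) \<partial>P)"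
  proof (rule ennreal_le_epsilon)
    fix d :: real assume "0 < d"
    \<comment> \<open>The denominator \<open>s + 1\<close> gives \<open>s * r <= d\<close> also when
      \<open>s = 0\<close>.\<close>
    define r where "r = d / (s + 1)"
    have r: "0 < r" "s * r \<le> d" using \<open>0 < d\<close> s unfolding r_def by (auto simp: field_simps)
    have "transport_cost C Q P < ennreal (\<epsilon> + r)"
      using Q r e unfolding ambiguity_ball_def by (auto intro: le_less_trans simp: ennreal_less_iff)
    then obtain \<beta> where \<beta>: "\<beta> \<in> couplings Q P" "(\<integral>\<^sup>+ z. ennreal (C z) \<partial>\<beta>) < ennreal (\<epsilon> + r)"
      unfolding transport_cost_def INF_less_iff by blast
    have dist: "distribution \<beta>" "distr \<beta> borel fst = P" "distr \<beta> borel snd = Q"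
      using \<beta> unfolding couplings_def by auto
    have sb: "sets \<beta> = sets borel" using dist unfolding distribution_def by blast
    have "(\<lambda>z. ennreal (C z)) \<in> borel_measurable borel" by measurable
    then have cm: "(\<lambda>z. ennreal (C z)) \<in> borel_measurable \<beta>" by (simp add: measurable_cong_sets[OF sb refl])
    have lfm: "(\<lambda>z. e2ennreal (l (fst z))) \<in> borel_measurable \<beta>"
      using measurable_compose[OF _ lm, of fst "borel :: ('a \<times> 'a) measure"]
      by (simp add: measurable_cong_sets[OF sb refl] borel_measurable_continuous_onI continuous_on_fst)
    have "(\<integral>\<^sup>+ x. ennreal (star_gauge K x) \<partial>Q) = (\<integral>\<^sup>+ z. ennreal (star_gauge K (snd z)) \<partial>\<beta>)"
      by (rule nn_integral_snd_coupling[symmetric, OF dist(1,3)]) measurable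
    also have "\<dots> \<le> (\<integral>\<^sup>+ z. ennreal s * ennreal (C z) + e2ennreal (l (fst z)) \<partial>\<beta>)"
    proof (rule nn_integral_mono)
      fix z :: "'a \<times> 'a"
      obtain x y where xy: "z = (x, y)" by (cases z)
      have "ereal (star_gauge K y) \<le> ereal s * ereal (C (x, y)) + l x"
        using z unfolding B_feasible_def by auto
      moreover have "0 \<le> l x" using B_feasible_nonneg(2)[OF z] .
      ultimately have "ennreal (star_gauge K y) \<le> ennreal (s * C (x, y)) + e2ennreal (l x)"
        using s C_nonneg[of "(x, y)"]
        by (cases "l x") (auto simp: ennreal_def[symmetric] simp flip: ennreal_plus intro: ennreal_leI)
      then show "ennreal (star_gauge K (snd z)) \<le> ennreal s * ennreal (C z) + e2ennreal (l (fst z))"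
        using s C_nonneg[of "(x, y)"] by (simp add: xy ennreal_mult)
    qed
    also have "\<dots> = ennreal s * (\<integral>\<^sup>+ z. ennreal (C z) \<partial>\<beta>) + (\<integral>\<^sup>+ x. e2ennreal (l x) \<partial>P)"
      using cm lfm by (simp add: nn_integral_add nn_integral_cmult nn_integral_fst_coupling[OF dist(1,2) lm])
    also have "\<dots> \<le> ennreal s * ennreal (\<epsilon> + r) + (\<integral>\<^sup>+ x. e2ennreal (l x) \<partial>P)"
      using \<beta>(2) by (intro add_right_mono mult_left_mono) auto
    also have "ennreal s * ennreal (\<epsilon> + r) = ennreal (s * \<epsilon> + s * r)"
      using s e r by (simp add: ennreal_mult[symmetric] algebra_simps)
    also have "\<dots> \<le> ennreal (s * \<epsilon> + d)" using r by (intro ennreal_leI) simp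
    also have "\<dots> = ennreal (s * \<epsilon>) + ennreal d" using s e \<open>0 < d\<close> by simp
    finally show "(\<integral>\<^sup>+ x. ennreal (star_gauge K x) \<partial>Q) \<le> ennreal (s * \<epsilon>) + (\<integral>\<^sup>+ x. e2ennreal (l x) \<partial>P) + ennreal d"
      by (simp add: ac_simps)
  qed
qed

section \<open>Transport plans and strong duality\<close>

text \<open>Only the first marginal is prescribed, so the set is convex; a plan of cost at most
  \<open>\<epsilon>\<close> has its second marginal in the ambiguity ball.\<close>

definition plans :: "('a \<times> 'a) measure set" where
  "plans = {\<beta>. distribution \<beta> \<and> distr \<beta> borel fst = P}"

lemma plan_gauge_le_worst:
  assumes \<beta>: "\<beta> \<in> plans" and K: "star_body K" and cost: "(\<integral>\<^sup>+ z. ennreal (C z) \<partial>\<beta>) \<le> ennreal \<epsilon>"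
  shows "(\<integral>\<^sup>+ z. ennreal (star_gauge K (snd z)) \<partial>\<beta>) \<le> worst_gauge \<epsilon> K"
proof -
  define Q where "Q = distr \<beta> borel snd"
  have d: "distribution \<beta>" "distr \<beta> borel fst = P" using \<beta> unfolding plans_def by auto
  have sb: "sets \<beta> = sets borel" using d unfolding distribution_def by blast
  have "snd \<in> \<beta> \<rightarrow>\<^sub>M (borel :: 'a measure)"
    by (subst measurable_cong_sets[OF sb refl]) (intro borel_measurable_continuous_onI continuous_on_snd continuous_on_id)
  then have "distribution Q" unfolding distribution_def Q_def
    using d unfolding distribution_def by (auto intro: prob_space.prob_space_distr)
  moreover have "\<beta> \<in> couplings Q P" unfolding couplings_def Q_def using d by simp
  then have "transport_cost C Q P \<le> ennreal \<epsilon>"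
    unfolding transport_cost_def using cost by (rule INF_lower2)
  ultimately have "Q \<in> ambiguity_ball C \<epsilon> P" unfolding ambiguity_ball_def by simp
  then have "(\<integral>\<^sup>+ x. ennreal (star_gauge K x) \<partial>Q) \<le> worst_gauge \<epsilon> K"
    unfolding worst_gauge_def by (rule SUP_upper)
  moreover have "(\<integral>\<^sup>+ z. ennreal (star_gauge K (snd z)) \<partial>\<beta>) = (\<integral>\<^sup>+ x. ennreal (star_gauge K x) \<partial>Q)"
    using star_gauge_borel_measurable[OF K] by (intro nn_integral_snd_coupling d) (auto simp: Q_def)
  ultimately show ?thesis by simp
qed

lemma graph_plan:
  assumes T: "T \<in> borel_measurable borel"
  defines "\<beta> \<equiv> distr P borel (\<lambda>x. (x, T x))"
  shows "\<beta> \<in> plans"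
    and "\<And>f. f \<in> borel_measurable borel \<Longrightarrow> (\<integral>\<^sup>+ z. f z \<partial>\<beta>) = (\<integral>\<^sup>+ x. f (x, T x) \<partial>P)"
proof -
  have m: "(\<lambda>x. (x, T x)) \<in> P \<rightarrow>\<^sub>M borel"
    using borel_measurable_Pair[OF measurable_ident T] by (simp add: measurable_cong_sets[OF sets_P refl])
  have "prob_space \<beta>" unfolding \<beta>_def by (rule prob_space_distr[OF m])
  moreover have "distr \<beta> borel fst = distr P borel (fst \<circ> (\<lambda>x. (x, T x)))"
    unfolding \<beta>_def by (rule distr_distr[OF _ m]) (intro borel_measurable_continuous_onI continuous_on_fst continuous_on_id)
  moreover have "distr P borel (fst \<circ> (\<lambda>x. (x, T x))) = P"
    by (simp add: o_def) (rule distr_id2, simp add: sets_P)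
  ultimately show "\<beta> \<in> plans" unfolding plans_def distribution_def by (simp add: \<beta>_def)
  show "(\<integral>\<^sup>+ z. f z \<partial>\<beta>) = (\<integral>\<^sup>+ x. f (x, T x) \<partial>P)" if "f \<in> borel_measurable borel" for f
    unfolding \<beta>_def using m that by (simp add: nn_integral_distr)
qed

lemma mixture_plan:
  assumes b: "\<beta>1 \<in> plans" "\<beta>2 \<in> plans" and p: "0 \<le> p" "p \<le> 1"
  obtains \<beta> where "\<beta> \<in> plans"
    "\<And>f. f \<in> borel_measurable borel \<Longrightarrow> (\<integral>\<^sup>+ z. f z \<partial>\<beta>)
       = ennreal p * (\<integral>\<^sup>+ z. f z \<partial>\<beta>1) + ennreal (1 - p) * (\<integral>\<^sup>+ z. f z \<partial>\<beta>2)"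
proof -
  define N where "N b = (if b then \<beta>1 else \<beta>2)" for b :: bool
  \<comment> \<open>A Bernoulli choice between the two plans realizes the convex combination as a
    monadic bind, which also supplies the formula for integrals.\<close>
  define \<beta> where "\<beta> = measure_pmf (bernoulli_pmf p) \<bind> N"
  have N: "N b \<in> plans" for b using b unfolding N_def by simp
  then have Nd: "prob_space (N b)" "sets (N b) = sets borel" "distr (N b) borel fst = P" for b
    unfolding plans_def distribution_def by blast+
  have Nm: "N \<in> measure_pmf (bernoulli_pmf p) \<rightarrow>\<^sub>M subprob_algebra borel"
    using Nd by (auto simp: space_subprob_algebra prob_space_imp_subprob_space)
  have int: "(\<integral>\<^sup>+ z. f z \<partial>\<beta>) = ennreal p * (\<integral>\<^sup>+ z. f z \<partial>\<beta>1) + ennreal (1 - p) * (\<integral>\<^sup>+ z. f z \<partial>\<beta>2)"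
    if "f \<in> borel_measurable borel" for f
    unfolding \<beta>_def nn_integral_bind[OF that Nm] using p by (simp add: N_def mult.commute)
  have sb: "sets \<beta> = sets borel" unfolding \<beta>_def by (rule sets_bind[OF Nd(2)]) simp
  have spb: "space \<beta> = UNIV" using sets_eq_imp_space_eq[OF sb] by simp
  have "emeasure (N b) UNIV = 1" for b
    using prob_space.emeasure_space_1[OF Nd(1)] sets_eq_imp_space_eq[OF Nd(2)] by (metis space_borel)
  then have one: "(\<integral>\<^sup>+ z. 1 \<partial>N b) = 1" for b
    using sets_eq_imp_space_eq[OF Nd(2)] by simp
  have "emeasure \<beta> (space \<beta>) = (\<integral>\<^sup>+ z. 1 \<partial>\<beta>)" by simp
  also have "\<dots> = ennreal p * 1 + ennreal (1 - p) * 1"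
    using int[of "\<lambda>_. 1"] one[of True] one[of False] unfolding N_def by simp
  also have "\<dots> = 1" using p by (simp flip: ennreal_plus)
  finally have "prob_space \<beta>" by (rule prob_spaceI)
  then have dist: "distribution \<beta>" unfolding distribution_def using sb by simp
  have fm: "fst \<in> borel_measurable (borel :: ('a \<times> 'a) measure)"
    by (intro borel_measurable_continuous_onI continuous_on_fst continuous_on_id)
  have fm': "fst \<in> \<beta> \<rightarrow>\<^sub>M (borel :: 'a measure)" using fm by (simp add: measurable_cong_sets[OF sb refl])
  have "distr \<beta> borel fst = P"
  proof (rule measure_eqI)
    show "sets (distr \<beta> borel fst) = sets P" by (simp add: sets_P)
    fix A assume "A \<in> sets (distr \<beta> borel fst)"
    then have A[measurable]: "A \<in> sets borel" by simp
    have im: "(\<lambda>z :: 'a \<times> 'a. indicator A (fst z) :: ennreal) \<in> borel_measurable borel"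
      by (rule measurable_compose[OF fm borel_measurable_indicator[OF A]])
    have "emeasure (distr \<beta> borel fst) A = (\<integral>\<^sup>+ x. indicator A x \<partial>distr \<beta> borel fst)" by simp
    also have "\<dots> = (\<integral>\<^sup>+ z. indicator A (fst z) \<partial>\<beta>)" by (rule nn_integral_distr[OF fm']) measurable
    also have "\<dots> = ennreal p * emeasure P A + ennreal (1 - p) * emeasure P A"
    proof -
      have "(\<integral>\<^sup>+ z. indicator A (fst z) \<partial>N b) = emeasure P A" for b
        using N[of b] nn_integral_fst_coupling[of "N b" "indicator A"] unfolding plans_def
        by (simp add: sets_P)
      from this[of True] this[of False] show ?thesis unfolding int[OF im] N_def by simp
    qed
    also have "\<dots> = emeasure P A" using p by (simp flip: ennreal_plus distrib_right)
    finally show "emeasure (distr \<beta> borel fst) A = emeasure P A" .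
  qed
  then have "\<beta> \<in> plans" unfolding plans_def using dist by simp
  then show ?thesis using that int by blast
qed

text \<open>The finite first moment of \<open>P\<close> enters the finiteness arguments through this
  bound.\<close>

lemma nn_integral_affine_norm_finite:
  assumes "0 \<le> a" "0 \<le> b"
  shows "(\<integral>\<^sup>+ x. ennreal (a + b * norm x) \<partial>P) < \<infinity>"
proof -
  have "integrable P (\<lambda>x. a + b * norm x)" using integrable_norm by simp
  then show ?thesis using assms by (simp add: nn_integral_eq_integral del: ennreal_plus)
qed

lemma nn_integral_gauge_finite:
  assumes "star_body K"
  shows "(\<integral>\<^sup>+ x. ennreal (star_gauge K x) \<partial>P) < \<infinity>"
proof -
  obtain m M where M: "0 < M" "\<And>x. star_gauge K x \<le> M * norm x" using star_gauge_bounds[OF assms] by metis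
  have "(\<integral>\<^sup>+ x. ennreal (star_gauge K x) \<partial>P) \<le> (\<integral>\<^sup>+ x. ennreal (0 + M * norm x) \<partial>P)"
    using M by (intro nn_integral_mono ennreal_leI) auto
  also have "\<dots> < \<infinity>" using M by (intro nn_integral_affine_norm_finite) auto
  finally show ?thesis .
qed

lemma expected_gauge_le_worst:
  assumes K: "star_body K"
  shows "(\<integral>\<^sup>+ x. ennreal (star_gauge K x) \<partial>P) \<le> worst_gauge \<epsilon> K"
proof -
  have T: "(\<lambda>x. x) \<in> borel_measurable (borel :: 'a measure)" by simp
  have [measurable]: "(\<lambda>z. ennreal (C z)) \<in> borel_measurable borel" by measurable
  have "(\<lambda>z. ennreal (star_gauge K (snd z))) \<in> borel_measurable (borel :: ('a \<times> 'a) measure)"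
    by (intro measurable_compose[OF _ measurable_ennreal] measurable_compose[OF _ star_gauge_borel_measurable[OF K]]
         borel_measurable_continuous_onI continuous_on_snd continuous_on_id)
  from graph_plan(2)[OF T this] plan_gauge_le_worst[OF graph_plan(1)[OF T] K, of \<epsilon>] show ?thesis
    by (simp add: graph_plan(2)[OF T])
qed

text \<open>For a far away \<open>y\<close>, moving to \<open>y\<close> all mass at points \<open>x\<close> with \<open>C (x, y) \<le> n\<close> has finite cost;
  for large \<open>n\<close> this is more than half of the mass.\<close>

lemma gauge_unbounded_over_finite_cost_plans:
  assumes K: "star_body K"
    and bound: "\<And>\<beta>. \<beta> \<in> plans \<Longrightarrow> (\<integral>\<^sup>+ z. ennreal (C z) \<partial>\<beta>) < \<infinity> \<Longrightarrow>
      (\<integral>\<^sup>+ z. ennreal (star_gauge K (snd z)) \<partial>\<beta>) < \<infinity> \<Longrightarrow>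
      (\<integral>\<^sup>+ z. ennreal (star_gauge K (snd z)) \<partial>\<beta>) \<le> ennreal V"
  shows False
proof -
  let ?g = "star_gauge K"
  note [measurable] = star_gauge_borel_measurable[OF K]
  obtain m M where m: "0 < m" "\<And>x. m * norm x \<le> ?g x"
    and M: "0 < M" "\<And>x. ?g x \<le> M * norm x" using star_gauge_bounds[OF K] by metis
  define W where "W = max V 0"
  have "0 \<le> W" unfolding W_def by simp
  \<comment> \<open>This length gives \<open>y\<close> gauge at least \<open>2 * (W + 1)\<close>, so
    sending more than half of the mass there pushes the expected gauge above
    \<open>W\<close>.\<close>
  obtain y :: 'a where y: "norm y = 2 * (W + 1) / m"
    using vector_choose_size[of "2 * (W + 1) / m"] m unfolding W_def by (auto simp: max_def)
  then have gy: "2 * (W + 1) \<le> ?g y" using m(2)[of y] m(1) by simp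
  define A where "A n = {x. C (x, y) \<le> real n}" for n
  have [measurable]: "A n \<in> sets borel" for n unfolding A_def by measurable
  have "(\<lambda>n. measure P (A n)) \<longlonglongrightarrow> measure P (\<Union>n. A n)"
    by (intro finite_Lim_measure_incseq) (auto simp: sets_P incseq_def A_def)
  moreover have "(\<Union>n. A n) = UNIV" unfolding A_def using real_arch_simple by auto
  ultimately have "(\<lambda>n. measure P (A n)) \<longlonglongrightarrow> 1" using prob_space by simp
  then have "\<forall>\<^sub>F n in sequentially. 1 / 2 < measure P (A n)" by (rule order_tendstoD) simp
  then obtain n where n: "1 / 2 < measure P (A n)" unfolding eventually_sequentially by blast
  define T where "T x = (if x \<in> A n then y else x)" for x
  have T[measurable]: "T \<in> borel_measurable borel" unfolding T_def by measurable
  have gm: "(\<lambda>z. ennreal (?g (snd z))) \<in> borel_measurable (borel :: ('a \<times> 'a) measure)"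
    by (intro measurable_compose[OF _ measurable_ennreal] measurable_compose[OF _ star_gauge_borel_measurable[OF K]]
         borel_measurable_continuous_onI continuous_on_snd continuous_on_id)
  have cm: "(\<lambda>z. ennreal (C z)) \<in> borel_measurable borel" by measurable
  have "(\<integral>\<^sup>+ x. ennreal (C (x, T x)) \<partial>P) \<le> (\<integral>\<^sup>+ x. ennreal (real n) \<partial>P)"
    by (intro nn_integral_mono ennreal_leI) (auto simp: T_def A_def)
  also have "\<dots> < \<infinity>" using emeasure_space_1 by simp
  finally have fin1: "(\<integral>\<^sup>+ x. ennreal (C (x, T x)) \<partial>P) < \<infinity>" .
  have "(\<integral>\<^sup>+ x. ennreal (?g (T x)) \<partial>P) \<le> (\<integral>\<^sup>+ x. ennreal (?g y + M * norm x) \<partial>P)"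
    using M star_gauge_nonneg[OF K]
    by (intro nn_integral_mono ennreal_leI) (auto simp: T_def intro: add_increasing)
  also have "\<dots> < \<infinity>" using M by (intro nn_integral_affine_norm_finite star_gauge_nonneg[OF K]) auto
  finally have "(\<integral>\<^sup>+ x. ennreal (?g (T x)) \<partial>P) \<le> ennreal V"
    using fin1 bound[OF graph_plan(1)[OF T]] by (simp add: graph_plan(2)[OF T] gm cm)
  moreover have "ennreal (?g y) * emeasure P (A n) \<le> (\<integral>\<^sup>+ x. ennreal (?g (T x)) \<partial>P)"
  proof -
    have "ennreal (?g y) * emeasure P (A n) = (\<integral>\<^sup>+ x. ennreal (?g y) * indicator (A n) x \<partial>P)"
      by (simp add: nn_integral_cmult_indicator sets_P)
    also have "\<dots> \<le> (\<integral>\<^sup>+ x. ennreal (?g (T x)) \<partial>P)"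
      by (intro nn_integral_mono) (auto simp: T_def indicator_def)
    finally show ?thesis .
  qed
  ultimately have "ennreal (?g y * measure P (A n)) \<le> ennreal V"
    by (simp add: emeasure_eq_measure ennreal_mult star_gauge_nonneg[OF K])
  also have "ennreal V \<le> ennreal W" unfolding W_def by (intro ennreal_leI) simp
  finally have "?g y * measure P (A n) \<le> W" using \<open>0 \<le> W\<close> by (simp add: ennreal_le_iff)
  moreover have "2 * (W + 1) * (1 / 2) \<le> ?g y * measure P (A n)"
    using gy n by (intro mult_mono) (auto simp: star_gauge_nonneg[OF K])
  ultimately show False by simp
qed

text \<open>The supporting line says \<open>e - s * c <= V - s * \<epsilon>\<close> for every pair
  in \<open>D\<close>. For the plan carried by the graph of \<open>T n\<close>, the left side is the
  integral of the gain of \<open>T n\<close>; monotone convergence then bounds the integral of the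
  transform.\<close>

lemma strong_duality:
  assumes K: "star_body K" and e: "0 < \<epsilon>" and fin: "worst_gauge \<epsilon> K < \<infinity>"
  obtains s where "0 < s"
    "ennreal (s * \<epsilon>) + (\<integral>\<^sup>+ x. c_transform (star_gauge K) s x \<partial>P) \<le> worst_gauge \<epsilon> K"
proof -
  let ?g = "star_gauge K"
  note [measurable] = star_gauge_borel_measurable[OF K]
  have g0: "0 \<le> ?g x" for x by (rule star_gauge_nonneg[OF K])
  have gm: "(\<lambda>z. ennreal (?g (snd z))) \<in> borel_measurable (borel :: ('a \<times> 'a) measure)"
    by (intro measurable_compose[OF _ measurable_ennreal] measurable_compose[OF _ star_gauge_borel_measurable[OF K]]
         borel_measurable_continuous_onI continuous_on_snd continuous_on_id)
  have cm: "(\<lambda>z. ennreal (C z)) \<in> borel_measurable borel" by measurable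
  obtain V where V: "0 \<le> V" "worst_gauge \<epsilon> K = ennreal V"
    using fin by (cases "worst_gauge \<epsilon> K") auto
  define D where "D = {(c, e). 0 \<le> c \<and> 0 \<le> e \<and> (\<exists>\<beta>\<in>plans. (\<integral>\<^sup>+ z. ennreal (C z) \<partial>\<beta>) = ennreal c \<and>
     (\<integral>\<^sup>+ z. ennreal (?g (snd z)) \<partial>\<beta>) = ennreal e)}"
  have conv: "(p * c + (1 - p) * c', p * e + (1 - p) * e') \<in> D"
    if D: "(c, e) \<in> D" "(c', e') \<in> D" and p: "0 \<le> p" "p \<le> 1" for c e c' e' p
  proof -
    from D(1) obtain \<beta>1 where 1: "\<beta>1 \<in> plans" "0 \<le> c" "0 \<le> e" "(\<integral>\<^sup>+ z. ennreal (C z) \<partial>\<beta>1) = ennreal c"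
        "(\<integral>\<^sup>+ z. ennreal (?g (snd z)) \<partial>\<beta>1) = ennreal e" unfolding D_def by auto
    from D(2) obtain \<beta>2 where 2: "\<beta>2 \<in> plans" "0 \<le> c'" "0 \<le> e'" "(\<integral>\<^sup>+ z. ennreal (C z) \<partial>\<beta>2) = ennreal c'"
        "(\<integral>\<^sup>+ z. ennreal (?g (snd z)) \<partial>\<beta>2) = ennreal e'" unfolding D_def by auto
    obtain \<beta> where \<beta>: "\<beta> \<in> plans"
      "\<And>f. f \<in> borel_measurable borel \<Longrightarrow> (\<integral>\<^sup>+ z. f z \<partial>\<beta>)
       = ennreal p * (\<integral>\<^sup>+ z. f z \<partial>\<beta>1) + ennreal (1 - p) * (\<integral>\<^sup>+ z. f z \<partial>\<beta>2)"
      using mixture_plan[OF 1(1) 2(1) p] by blast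
    have "(\<integral>\<^sup>+ z. ennreal (C z) \<partial>\<beta>) = ennreal (p * c + (1 - p) * c')"
      using \<beta>(2)[OF cm] 1 2 p by (simp add: ennreal_mult)
    moreover have "(\<integral>\<^sup>+ z. ennreal (?g (snd z)) \<partial>\<beta>) = ennreal (p * e + (1 - p) * e')"
      using \<beta>(2)[OF gm] 1 2 p by (simp add: ennreal_mult)
    ultimately show ?thesis unfolding D_def using \<beta>(1) 1 2 p by auto
  qed
  have bound: "e' \<le> V" if "(c, e') \<in> D" "c \<le> \<epsilon>" for c e'
  proof -
    from that(1) obtain \<beta> where b: "\<beta> \<in> plans" "(\<integral>\<^sup>+ z. ennreal (C z) \<partial>\<beta>) = ennreal c"
        "(\<integral>\<^sup>+ z. ennreal (?g (snd z)) \<partial>\<beta>) = ennreal e'" unfolding D_def by auto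
    have "ennreal e' \<le> ennreal V"
      using plan_gauge_le_worst[OF b(1) K, of \<epsilon>] b V that(2) by (simp add: ennreal_leI)
    then show ?thesis using V(1) by (simp add: ennreal_le_iff)
  qed
  have id: "(\<lambda>x. x) \<in> borel_measurable (borel :: 'a measure)" by simp
  obtain e0 where e0: "0 \<le> e0" "(\<integral>\<^sup>+ x. ennreal (?g x) \<partial>P) = ennreal e0"
    using nn_integral_gauge_finite[OF K] by (cases "\<integral>\<^sup>+ x. ennreal (?g x) \<partial>P") auto
  \<comment> \<open>The identity plan plays the role of a Slater point: its cost 0 lies strictly
    below \<open>\<epsilon>\<close>.\<close>
  have base: "(0, e0) \<in> D"
  proof -
    have "(\<integral>\<^sup>+ z. ennreal (C z) \<partial>distr P borel (\<lambda>x. (x, x))) = ennreal 0"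
      using graph_plan(2)[OF id cm] by simp
    moreover have "(\<integral>\<^sup>+ z. ennreal (?g (snd z)) \<partial>distr P borel (\<lambda>x. (x, x))) = ennreal e0"
      using graph_plan(2)[OF id gm] e0(2) by simp
    ultimately show ?thesis
      unfolding D_def mem_Collect_eq prod.case using graph_plan(1)[OF id] e0(1) by blast
  qed
  have "\<exists>s\<ge>0. \<forall>c e. (c, e) \<in> D \<longrightarrow> e \<le> V + s * (c - \<epsilon>)"
  proof (rule supporting_slope[OF conv base e bound])
    fix s assume "0 \<le> s" "\<And>c e. (c, e) \<in> D \<Longrightarrow> e \<le> V + s * (c - \<epsilon>)"
    then show ?thesis by (intro exI[of _ s]) auto
  qed
  then obtain s where s: "0 \<le> s" and slope: "\<And>c e. (c, e) \<in> D \<Longrightarrow> e \<le> V + s * (c - \<epsilon>)"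
    by auto
  have D_of_plan: "(\<exists>c e. (c, e) \<in> D \<and> (\<integral>\<^sup>+ z. ennreal (C z) \<partial>\<beta>) = ennreal c \<and>
     (\<integral>\<^sup>+ z. ennreal (?g (snd z)) \<partial>\<beta>) = ennreal e \<and> 0 \<le> c \<and> 0 \<le> e)"
    if plan: "\<beta> \<in> plans" and fin: "(\<integral>\<^sup>+ z. ennreal (C z) \<partial>\<beta>) < \<infinity>" "(\<integral>\<^sup>+ z. ennreal (?g (snd z)) \<partial>\<beta>) < \<infinity>" for \<beta>
  proof -
    obtain c where "0 \<le> c" "(\<integral>\<^sup>+ z. ennreal (C z) \<partial>\<beta>) = ennreal c"
      using fin(1) by (cases "\<integral>\<^sup>+ z. ennreal (C z) \<partial>\<beta>") auto
    moreover obtain e where "0 \<le> e" "(\<integral>\<^sup>+ z. ennreal (?g (snd z)) \<partial>\<beta>) = ennreal e"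
      using fin(2) by (cases "\<integral>\<^sup>+ z. ennreal (?g (snd z)) \<partial>\<beta>") auto
    ultimately show ?thesis using plan unfolding D_def by blast
  qed
  have "s \<noteq> 0"
  proof
    assume "s = 0"
    show False
    proof (rule gauge_unbounded_over_finite_cost_plans[OF K, of V])
      fix \<beta> assume "\<beta> \<in> plans" "(\<integral>\<^sup>+ z. ennreal (C z) \<partial>\<beta>) < \<infinity>" "(\<integral>\<^sup>+ z. ennreal (?g (snd z)) \<partial>\<beta>) < \<infinity>"
      from D_of_plan[OF this] obtain c e where "(c, e) \<in> D" "(\<integral>\<^sup>+ z. ennreal (?g (snd z)) \<partial>\<beta>) = ennreal e"
        by blast
      then show "(\<integral>\<^sup>+ z. ennreal (?g (snd z)) \<partial>\<beta>) \<le> ennreal V"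
        using slope[of c e] \<open>s = 0\<close> by (simp add: ennreal_leI)
    qed
  qed
  then have s0: "0 < s" using s by simp
  obtain m M where M: "0 < M" "\<And>x. ?g x \<le> M * norm x" using star_gauge_bounds[OF K] by metis
  obtain T :: "nat \<Rightarrow> 'a \<Rightarrow> 'a" where T[measurable]: "\<And>n. T n \<in> borel_measurable borel"
    and Tn: "\<And>n x. norm (T n x) \<le> real n + norm x"
    and ge: "\<And>n x. ?g x \<le> ?g (T n x) - s * C (x, T n x)"
    and inc: "\<And>x. incseq (\<lambda>n. ennreal (?g (T n x) - s * C (x, T n x)))"
    and eq: "\<And>x. c_transform ?g s x = (SUP n. ennreal (?g (T n x) - s * C (x, T n x)))"
    using c_transform_selectors[OF continuous_on_star_gauge[OF K] s] by blast
  \<comment> \<open>The inequality \<open>s * \<epsilon> <= V\<close> is carried along because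
    \<open>ennreal\<close> truncates negative numbers; it is needed to recombine the two summands
    into \<open>V\<close> at the end.\<close>
  have I: "s * \<epsilon> \<le> V \<and> (\<integral>\<^sup>+ x. ennreal (?g (T n x) - s * C (x, T n x)) \<partial>P) \<le> ennreal (V - s * \<epsilon>)" for n
  proof -
    let ?\<beta> = "distr P borel (\<lambda>x. (x, T n x))"
    let ?I = "\<integral>\<^sup>+ x. ennreal (?g (T n x) - s * C (x, T n x)) \<partial>P"
    have gT: "?g (T n x) \<le> M * real n + M * norm x" for x
      using M(2)[of "T n x"] mult_left_mono[OF Tn[of n x], of M] M(1) by (simp add: distrib_left)
    \<comment> \<open>The gain is at least \<open>g x >= 0\<close>, so \<open>s * C\<close> is at
      most the gauge of the target; dividing by \<open>s > 0\<close> makes the cost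
      integrable.\<close>
    have cT: "C (x, T n x) \<le> M * real n / s + M / s * norm x" for x
    proof -
      have "s * C (x, T n x) \<le> M * real n + M * norm x" using ge[of x n] g0[of x] gT[of x] by linarith
      then show ?thesis using s0 by (simp add: field_simps)
    qed
    have plan: "?\<beta> \<in> plans" by (rule graph_plan(1)[OF T])
    have Cint: "(\<integral>\<^sup>+ z. ennreal (C z) \<partial>?\<beta>) = (\<integral>\<^sup>+ x. ennreal (C (x, T n x)) \<partial>P)"
      by (rule graph_plan(2)[OF T cm])
    have gint: "(\<integral>\<^sup>+ z. ennreal (?g (snd z)) \<partial>?\<beta>) = (\<integral>\<^sup>+ x. ennreal (?g (T n x)) \<partial>P)"
      using graph_plan(2)[OF T gm] by simp
    have "(\<integral>\<^sup>+ z. ennreal (C z) \<partial>?\<beta>) \<le> (\<integral>\<^sup>+ x. ennreal (M * real n / s + M / s * norm x) \<partial>P)"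
      unfolding Cint by (intro nn_integral_mono ennreal_leI cT)
    also have "\<dots> < \<infinity>" using M s0 by (intro nn_integral_affine_norm_finite) auto
    finally have fin1: "(\<integral>\<^sup>+ z. ennreal (C z) \<partial>?\<beta>) < \<infinity>" .
    have "(\<integral>\<^sup>+ z. ennreal (?g (snd z)) \<partial>?\<beta>) \<le> (\<integral>\<^sup>+ x. ennreal (M * real n + M * norm x) \<partial>P)"
      unfolding gint by (intro nn_integral_mono ennreal_leI gT)
    also have "\<dots> < \<infinity>" using M by (intro nn_integral_affine_norm_finite) auto
    finally have fin2: "(\<integral>\<^sup>+ z. ennreal (?g (snd z)) \<partial>?\<beta>) < \<infinity>" .
    obtain c e where ce: "(c, e) \<in> D" "(\<integral>\<^sup>+ x. ennreal (C (x, T n x)) \<partial>P) = ennreal c"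
      "(\<integral>\<^sup>+ x. ennreal (?g (T n x)) \<partial>P) = ennreal e" "0 \<le> c" "0 \<le> e"
      using D_of_plan[OF plan fin1 fin2] Cint gint by auto
    \<comment> \<open>The gauge is written as gain plus cost, which avoids truncated subtraction in
      \<open>ennreal\<close>.\<close>
    have "ennreal e = (\<integral>\<^sup>+ x. ennreal (?g (T n x) - s * C (x, T n x)) + ennreal s * ennreal (C (x, T n x)) \<partial>P)"
      unfolding ce(3)[symmetric]
    proof (rule nn_integral_cong)
      fix x
      have "0 \<le> ?g (T n x) - s * C (x, T n x)" using ge[of x n] g0[of x] by linarith
      then show "ennreal (?g (T n x)) = ennreal (?g (T n x) - s * C (x, T n x)) + ennreal s * ennreal (C (x, T n x))"
        using s C_nonneg[of "(x, T n x)"] by (simp add: ennreal_mult[symmetric] ennreal_plus[symmetric] del: ennreal_plus)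
    qed
    also have "\<dots> = ?I + ennreal s * ennreal c"
      by (simp add: nn_integral_add nn_integral_cmult ce(2))
    finally have eI: "ennreal e = ?I + ennreal (s * c)" using s ce by (simp add: ennreal_mult)
    then have "?I < \<infinity>" by (metis ennreal_less_top ennreal_add_eq_top infinity_ennreal_def less_top)
    then obtain r where r: "0 \<le> r" "?I = ennreal r" by (cases ?I) auto
    have "e = r + s * c" using eI r s ce by (simp add: ennreal_plus[symmetric] del: ennreal_plus)
    then have "r \<le> V - s * \<epsilon>" using slope[OF ce(1)] by (simp add: algebra_simps)
    then show ?thesis using r by (auto intro: ennreal_leI)
  qed
  have "(\<integral>\<^sup>+ x. c_transform ?g s x \<partial>P) = (SUP n. \<integral>\<^sup>+ x. ennreal (?g (T n x) - s * C (x, T n x)) \<partial>P)"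
    unfolding eq using inc
    by (intro nn_integral_monotone_convergence_SUP) (auto simp: incseq_def le_fun_def)
  also have "\<dots> \<le> ennreal (V - s * \<epsilon>)" using I by (intro SUP_least) blast
  finally have "ennreal (s * \<epsilon>) + (\<integral>\<^sup>+ x. c_transform ?g s x \<partial>P) \<le> ennreal (s * \<epsilon>) + ennreal (V - s * \<epsilon>)"
    by (rule add_left_mono)
  also have "\<dots> = worst_gauge \<epsilon> K" using I[of 0] s e V by (simp add: ennreal_plus[symmetric] del: ennreal_plus)
  finally show ?thesis using that[OF s0] by blast
qed

section \<open>Radius zero: collapse of the ambiguity ball and large multipliers\<close>

lemma compact_le_of_ambiguity_zero:
  assumes Q: "Q \<in> ambiguity_ball C 0 P" and F: "compact F"
  shows "emeasure Q F \<le> emeasure P F"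
proof (rule ennreal_le_epsilon)
  \<comment> \<open>On \<open>G \<times> F\<close>, with \<open>G\<close> a compact subset of \<open>- F\<close> carrying almost all of its mass, the cost is
    bounded below by a positive constant, so nearly free plans hardly charge \<open>G \<times> F\<close>.\<close>
  fix d :: real assume "0 < d"
  have Fb: "F \<in> sets borel" using F by (simp add: compact_imp_closed)
  have "emeasure P (- F) < emeasure P (- F) + ennreal (d / 2)"
    using \<open>0 < d\<close> by (simp add: emeasure_eq_measure ennreal_plus[symmetric] ennreal_less_iff del: ennreal_plus)
  moreover have "emeasure P (- F) = (SUP G\<in>{G. G \<subseteq> - F \<and> compact G}. emeasure P G)"
    using Fb emeasure_space_1 by (intro inner_regular sets_P) auto
  moreover have "(SUP G\<in>{G. G \<subseteq> - F \<and> compact G}. emeasure P G) + ennreal (d / 2)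
      = (SUP G\<in>{G. G \<subseteq> - F \<and> compact G}. emeasure P G + ennreal (d / 2))"
    by (rule ennreal_SUP_add_left[symmetric]) auto
  ultimately have "emeasure P (- F) < (SUP G\<in>{G. G \<subseteq> - F \<and> compact G}. emeasure P G + ennreal (d / 2))"
    by simp
  then obtain G where G: "G \<subseteq> - F" "compact G" "emeasure P (- F) < emeasure P G + ennreal (d / 2)"
    unfolding less_SUP_iff by blast
  have Gb: "G \<in> sets borel" using G by (simp add: compact_imp_closed)
  have compl: "measure P (- A) = 1 - measure P A" if "A \<in> sets borel" for A
    using prob_compl[of A] that by (simp add: sets_P Compl_eq_Diff_UNIV)
  have "measure P (- F) < measure P G + d / 2"
    using G(3) \<open>0 < d\<close> by (simp add: emeasure_eq_measure ennreal_plus[symmetric] ennreal_less_iff del: ennreal_plus)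
  then have PG: "measure P (- G) \<le> measure P F + d / 2"
    using compl[OF Fb] compl[OF Gb] by simp
  have "\<exists>c>0. \<forall>z\<in>G \<times> F. c \<le> C z"
  proof (cases "G \<times> F = {}")
    case True
    then show ?thesis by (auto intro!: exI[of _ 1])
  next
    case False
    then obtain z where z: "z \<in> G \<times> F" "\<forall>w\<in>G \<times> F. C z \<le> C w"
      using lsc_attains_inf[OF C_lsc compact_Times[OF G(2) F]] by blast
    then have "fst z \<noteq> snd z" using G(1) by auto
    then have "0 < C z" using C_nonneg[of z] C_zero_iff[of "fst z" "snd z"] by simp
    then show ?thesis using z by blast
  qed
  then obtain c where c: "0 < c" "\<And>z. z \<in> G \<times> F \<Longrightarrow> c \<le> C z" by blast
  \<comment> \<open>Since \<open>C >= c\<close> on \<open>G \<times> F\<close>, Markov's inequality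
    turns a cost below \<open>c * (d / 2)\<close> into mass at most \<open>d / 2\<close> there; the
    other \<open>d / 2\<close> is the error in choosing \<open>G\<close>.\<close>
  have "transport_cost C Q P < ennreal (c * (d / 2))"
    using Q c \<open>0 < d\<close> unfolding ambiguity_ball_def by (simp add: ennreal_less_zero_iff)
  then obtain \<beta> where \<beta>: "\<beta> \<in> couplings Q P" "(\<integral>\<^sup>+ z. ennreal (C z) \<partial>\<beta>) < ennreal (c * (d / 2))"
    unfolding transport_cost_def INF_less_iff by blast
  have dist: "distribution \<beta>" "distr \<beta> borel fst = P" "distr \<beta> borel snd = Q"
    using \<beta> unfolding couplings_def by auto
  have sb: "sets \<beta> = sets borel" using dist unfolding distribution_def by blast
  have fm: "fst \<in> borel_measurable (borel :: ('a \<times> 'a) measure)"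
    and sm: "snd \<in> borel_measurable (borel :: ('a \<times> 'a) measure)"
    by (intro borel_measurable_continuous_onI continuous_on_fst continuous_on_snd continuous_on_id)+
  have Gm: "(\<lambda>z :: 'a \<times> 'a. indicator (- G) (fst z) :: ennreal) \<in> borel_measurable borel"
    by (rule measurable_compose[OF fm borel_measurable_indicator]) (use Gb in simp)
  have GFm: "(\<lambda>z :: 'a \<times> 'a. indicator (G \<times> F) z :: ennreal) \<in> borel_measurable borel"
    using compact_Times[OF G(2) F] by (intro borel_measurable_indicator) (simp add: compact_imp_closed)
  have m1: "(\<lambda>z. indicator (- G) (fst z) :: ennreal) \<in> borel_measurable \<beta>"
     and m2: "(\<lambda>z. indicator (G \<times> F) z :: ennreal) \<in> borel_measurable \<beta>"
    using Gm GFm by (simp_all add: measurable_cong_sets[OF sb refl])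
  have Qs: "sets Q = sets borel" using Q unfolding ambiguity_ball_def distribution_def by blast
  have "emeasure Q F = (\<integral>\<^sup>+ y. indicator F y \<partial>Q)" using Fb Qs by simp
  also have "\<dots> = (\<integral>\<^sup>+ z. indicator F (snd z) \<partial>\<beta>)"
    by (rule nn_integral_snd_coupling[symmetric, OF dist(1,3)]) (use Fb in simp)
  \<comment> \<open>Mass arriving in \<open>F\<close> either starts outside \<open>G\<close>, which
    has \<open>P\<close>-mass at most that of \<open>F\<close> plus \<open>d / 2\<close>, or lies on
    \<open>G \<times> F\<close>.\<close>
  also have "\<dots> \<le> (\<integral>\<^sup>+ z. indicator (- G) (fst z) + indicator (G \<times> F) z \<partial>\<beta>)"
    by (intro nn_integral_mono) (auto simp: indicator_def)
  also have "\<dots> = (\<integral>\<^sup>+ z. indicator (- G) (fst z) \<partial>\<beta>) + (\<integral>\<^sup>+ z. indicator (G \<times> F) z \<partial>\<beta>)"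
    using m1 m2 by (rule nn_integral_add)
  also have "(\<integral>\<^sup>+ z. indicator (- G) (fst z) \<partial>\<beta>) = emeasure P (- G)"
    using nn_integral_fst_coupling[OF dist(1,2), of "indicator (- G)"] Gb by (simp add: sets_P)
  also have "(\<integral>\<^sup>+ z. indicator (G \<times> F) z \<partial>\<beta>) \<le> ennreal (d / 2)"
  proof -
    have "ennreal c * (\<integral>\<^sup>+ z. indicator (G \<times> F) z \<partial>\<beta>) = (\<integral>\<^sup>+ z. ennreal c * indicator (G \<times> F) z \<partial>\<beta>)"
      using m2 by (simp add: nn_integral_cmult)
    also have "\<dots> \<le> (\<integral>\<^sup>+ z. ennreal (C z) \<partial>\<beta>)"
      by (intro nn_integral_mono) (auto simp: indicator_def intro!: ennreal_leI c(2))
    also have "\<dots> \<le> ennreal c * ennreal (d / 2)"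
      using \<beta>(2) c \<open>0 < d\<close> by (simp add: ennreal_mult[symmetric])
    finally show ?thesis using c(1) by (simp add: ennreal_mult_le_mult_iff)
  qed
  also have "emeasure P (- G) + ennreal (d / 2) \<le> emeasure P F + ennreal d"
    using PG \<open>0 < d\<close> by (simp add: emeasure_eq_measure ennreal_plus[symmetric] ennreal_leI del: ennreal_plus)
  finally show "emeasure Q F \<le> emeasure P F + ennreal d" by (simp add: add_left_mono)
qed

text \<open>The transport cost is an infimum that need not be attained, so this is not immediate even
  though \<open>C\<close> vanishes only on the diagonal.\<close>

lemma ambiguity_ball_zero:
  assumes Q: "Q \<in> ambiguity_ball C 0 P"
  shows "Q = P"
proof (rule measure_eqI)
  have Qd: "prob_space Q" and Qs: "sets Q = sets borel"
    using Q unfolding ambiguity_ball_def distribution_def by auto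
  interpret Q: prob_space Q by (rule Qd)
  have spQ: "space Q = UNIV" using sets_eq_imp_space_eq[OF Qs] by simp
  show "sets Q = sets P" by (simp add: Qs sets_P)
  \<comment> \<open>Inner regularity extends the comparison from compact sets to Borel sets. Both
    measures have total mass 1, so applying it to complements gives equality.\<close>
  have le: "measure Q A \<le> measure P A" if A: "A \<in> sets borel" for A
  proof -
    have "emeasure Q A = (SUP F\<in>{F. F \<subseteq> A \<and> compact F}. emeasure Q F)"
      using A Q.emeasure_space_1 by (intro inner_regular Qs) auto
    also have "\<dots> \<le> emeasure P A"
    proof (rule SUP_least)
      fix F assume "F \<in> {F. F \<subseteq> A \<and> compact F}"
      then have "emeasure Q F \<le> emeasure P F" "emeasure P F \<le> emeasure P A"
        using A by (auto intro: compact_le_of_ambiguity_zero[OF Q] emeasure_mono simp: sets_P)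
      then show "emeasure Q F \<le> emeasure P A" by (rule order_trans)
    qed
    finally show ?thesis by (simp add: Q.emeasure_eq_measure emeasure_eq_measure)
  qed
  fix A assume "A \<in> sets Q"
  then have A: "A \<in> sets borel" by (simp add: Qs)
  have "measure Q (- A) = 1 - measure Q A" "measure P (- A) = 1 - measure P A"
    using Q.prob_compl[of A] prob_compl[of A] A by (simp_all add: Qs sets_P spQ Compl_eq_Diff_UNIV)
  then have "measure Q A = measure P A" using le[OF A] le[of "- A"] A by simp
  then show "emeasure Q A = emeasure P A" by (simp add: Q.emeasure_eq_measure emeasure_eq_measure)
qed

lemma worst_gauge_zero:
  assumes K: "star_body K"
  shows "worst_gauge 0 K = (\<integral>\<^sup>+ x. ennreal (star_gauge K x) \<partial>P)"
proof (rule antisym)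
  show "worst_gauge 0 K \<le> (\<integral>\<^sup>+ x. ennreal (star_gauge K x) \<partial>P)"
    unfolding worst_gauge_def by (rule SUP_least) (auto dest: ambiguity_ball_zero)
qed (rule expected_gauge_le_worst[OF K])

text \<open>Where \<open>g - s C (x, \<cdot>)\<close> is bounded by \<open>w\<close>, points with \<open>g y > 2 w\<close> drop out as soon as the
  multiplier has doubled, and lower semicontinuity handles the compact rest.\<close>

lemma c_transform_tendsto:
  fixes g :: "'a \<Rightarrow> real"
  assumes g: "continuous_on UNIV g" and g0: "\<And>y. 0 \<le> g y"
    and m: "0 < m" "\<And>y. m * norm y \<le> g y"
    and s: "0 < s" and fin: "c_transform g s x < \<infinity>"
  shows "(\<lambda>n. c_transform g (s + real n) x) \<longlonglongrightarrow> ennreal (g x)"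
proof (rule order_tendstoI)
  fix a assume "a < ennreal (g x)"
  then show "\<forall>\<^sub>F n in sequentially. a < c_transform g (s + real n) x"
    using c_transform_ge_self by (intro always_eventually) (auto intro: less_le_trans)
next
  fix a assume "ennreal (g x) < a"
  then obtain b where b: "ennreal (g x) < b" "b < a" using dense by blast
  then obtain r where r: "0 \<le> r" "b = ennreal r" by (cases b) auto
  have rg: "g x < r" using b r g0[of x] by (simp add: ennreal_less_iff)
  obtain w where w: "0 \<le> w" "c_transform g s x = ennreal w" using fin by (cases "c_transform g s x") auto
  have gw: "g y - s * C (x, y) \<le> w" for y
    using c_transform_ge[of g y s x] w by (simp add: ennreal_le_iff)
  \<comment> \<open>The compact set of targets that could still beat \<open>r\<close>. It does not
    contain \<open>x\<close>, because \<open>g x < r\<close>, so the cost from \<open>x\<close> is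
    bounded away from 0 on it.\<close>
  define S where "S = {y. g y \<le> 2 * w} \<inter> {y. r \<le> g y}"
  have "closed S" unfolding S_def
    by (intro closed_Int closed_Collect_le g continuous_on_const)
  moreover have "bounded S" unfolding bounded_iff
  proof (intro exI ballI)
    fix y assume "y \<in> S"
    then have "m * norm y \<le> 2 * w" using m(2)[of y] unfolding S_def by simp
    then show "norm y \<le> 2 * w / m" using m(1) by (simp add: field_simps)
  qed
  ultimately have comp: "compact S" by (simp add: compact_eq_bounded_closed)
  have lsc_sec: "lsc (\<lambda>y. C (x, y))" by (intro lsc_compose_continuous[OF C_lsc] continuous_intros)
  have "\<exists>c>0. \<forall>y\<in>S. c \<le> C (x, y)"
  proof (cases "S = {}")
    case True
    then show ?thesis by (auto intro!: exI[of _ 1])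
  next
    case False
    then obtain y where y: "y \<in> S" "\<forall>z\<in>S. C (x, y) \<le> C (x, z)"
      using lsc_attains_inf[OF lsc_sec comp] by blast
    then have "x \<noteq> y" using rg unfolding S_def by auto
    then have "0 < C (x, y)" using C_nonneg[of "(x, y)"] C_zero_iff[of x y] by simp
    then show ?thesis using y by blast
  qed
  then obtain c where c: "0 < c" "\<And>y. y \<in> S \<Longrightarrow> c \<le> C (x, y)" by blast
  \<comment> \<open>The bound \<open>n >= w / c\<close> disposes of targets in \<open>S\<close>. The
    bound \<open>n >= s\<close> disposes of those with \<open>g y > 2 * w\<close>: there
    \<open>s * C (x, y) > w\<close>, and a second copy of this cost exceeds the remaining
    gain.\<close>
  obtain N where N: "max s (w / c) \<le> real N" using real_arch_simple by blast
  show "\<forall>\<^sub>F n in sequentially. c_transform g (s + real n) x < a"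
  proof (rule eventually_sequentiallyI[of N])
    fix n assume "N \<le> n"
    then have n: "s \<le> real n" "w / c \<le> real n" using N by auto
    have "g y - (s + real n) * C (x, y) \<le> r" for y
    proof -
      have split: "g y - (s + real n) * C (x, y) = g y - s * C (x, y) - real n * C (x, y)"
        by (simp add: algebra_simps)
      have nn: "0 \<le> s * C (x, y)" "0 \<le> real n * C (x, y)" using C_nonneg s by simp_all
      consider "g y < r" | "y \<in> S" | "2 * w < g y" unfolding S_def by force
      then show ?thesis
      proof cases
        case 1
        then show ?thesis using split nn by linarith
      next
        case 2
        have "w \<le> real n * c" using n(2) c(1) by (simp add: pos_divide_le_eq)
        also have "\<dots> \<le> real n * C (x, y)" using c(2)[OF 2] by (intro mult_left_mono) auto
        finally show ?thesis using split gw[of y] r(1) by linarith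
      next
        case 3
        have "s * C (x, y) \<le> real n * C (x, y)" using n(1) C_nonneg by (intro mult_right_mono) auto
        then show ?thesis using split gw[of y] 3 r(1) by linarith
      qed
    qed
    then have "c_transform g (s + real n) x \<le> b"
      unfolding c_transform_def r(2) by (intro SUP_least ennreal_leI)
    then show "c_transform g (s + real n) x < a" using b(2) by (rule le_less_trans)
  qed
qed

text \<open>Any two gauges are comparable, so a finite multiplier that works for one body yields,
  after scaling, one that works for every body.\<close>

lemma c_transform_gauge_comparison:
  assumes z: "(K0, ereal s0, l0) \<in> B_feasible S C P" and s0: "0 \<le> s0" and K: "star_body K"
  obtains s where "0 < s" "(\<integral>\<^sup>+ x. c_transform (star_gauge K) s x \<partial>P) < \<infinity>"
proof -
  have K0: "star_body K0" and l0: "l0 \<in> L1 P" using z unfolding B_feasible_def by auto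
  obtain M where M: "0 < M" "\<And>x. star_gauge K x \<le> M * norm x" using star_gauge_bounds[OF K] by metis
  obtain m where m: "0 < m" "\<And>x. m * norm x \<le> star_gauge K0 x" using star_gauge_bounds[OF K0] by metis
  define k where "k = M / m"
  have k: "0 < k" unfolding k_def using M m by simp
  have gk: "star_gauge K y \<le> k * star_gauge K0 y" for y
  proof -
    have "star_gauge K y \<le> M * norm y" by (rule M)
    also have "\<dots> = k * (m * norm y)" unfolding k_def using m by simp
    also have "\<dots> \<le> k * star_gauge K0 y" using k m(2)[of y] by (intro mult_left_mono) auto
    finally show ?thesis .
  qed
  \<comment> \<open>The summand 1 makes the multiplier positive even for \<open>s0 = 0\<close>, as
    the limit argument requires.\<close>
  define s where "s = k * s0 + 1"
  have s: "0 < s" unfolding s_def using k s0 by (simp add: add_nonneg_pos)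
  have le: "c_transform (star_gauge K) s x \<le> ennreal k * e2ennreal (l0 x)" for x
    unfolding c_transform_def
  proof (rule SUP_least)
    fix y
    have "star_gauge K y - s * C (x, y) \<le> k * (star_gauge K0 y - s0 * C (x, y))"
      using gk[of y] C_nonneg[of "(x, y)"] unfolding s_def by (simp add: algebra_simps)
    then have "ennreal (star_gauge K y - s * C (x, y)) \<le> ennreal (k * (star_gauge K0 y - s0 * C (x, y)))"
      by (rule ennreal_leI)
    also have "\<dots> = ennreal k * ennreal (star_gauge K0 y - s0 * C (x, y))"
      using k by (simp add: ennreal_mult')
    also have "\<dots> \<le> ennreal k * e2ennreal (l0 x)"
      using c_transform_ge[of "star_gauge K0" y s0 x] c_transform_le_feasible[OF z, of x]
      by (intro mult_left_mono) auto
    finally show "ennreal (star_gauge K y - s * C (x, y)) \<le> ennreal k * e2ennreal (l0 x)" .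
  qed
  have [measurable]: "l0 \<in> borel_measurable P" using l0 unfolding L1_def by blast
  have "(\<integral>\<^sup>+ x. c_transform (star_gauge K) s x \<partial>P) \<le> (\<integral>\<^sup>+ x. ennreal k * e2ennreal (l0 x) \<partial>P)"
    by (intro nn_integral_mono le)
  also have "\<dots> = ennreal k * (\<integral>\<^sup>+ x. e2ennreal (l0 x) \<partial>P)" by (intro nn_integral_cmult) measurable
  also have "\<dots> < \<infinity>"
    using L1_nonneg_integral(2)[OF l0 B_feasible_nonneg(2)[OF z]] by (simp add: ennreal_mult_less_top)
  finally show ?thesis using that s by blast
qed

text \<open>At radius 0 the term \<open>s * \<epsilon>\<close> is free, so the multiplier may grow.
  The transforms converge almost everywhere to the gauge and are dominated by the first one;
  attainment of the limit is not claimed.\<close>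

lemma dual_infimum_zero:
  assumes z: "B_feasible {0..<\<infinity>} C P \<noteq> {}" and K: "star_body K" "emeasure lborel K \<le> 1"
  shows "(INF z\<in>{z \<in> B_feasible {0..<\<infinity>} C P. fst z = K}. B_objective 0 P z) \<le> A_objective C 0 P K"
proof -
  let ?g = "star_gauge K"
  obtain K0 s' l0 where z0: "(K0, s', l0) \<in> B_feasible {0..<\<infinity>} C P" using z by auto
  then have "0 \<le> s'" "s' < \<infinity>" unfolding B_feasible_def by auto
  then obtain s0 where "s' = ereal s0" "0 \<le> s0" by (cases s') auto
  then obtain s where s: "0 < s" and fin: "(\<integral>\<^sup>+ x. c_transform ?g s x \<partial>P) < \<infinity>"
    using c_transform_gauge_comparison[of K0 s0 l0 _ K] z0 K by blast
  note [measurable] = star_gauge_borel_measurable[OF K(1)]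
  have [measurable]: "c_transform ?g t \<in> borel_measurable borel" if "0 \<le> t" for t
    using that by (intro c_transform_borel_measurable continuous_on_star_gauge K)
  define u where "u n x = c_transform ?g (s + real n) x" for n x
  have um[measurable]: "u n \<in> borel_measurable borel" for n
    unfolding u_def using s by simp
  have cs: "c_transform ?g s \<in> borel_measurable borel" using s by simp
  have ule: "u n x \<le> c_transform ?g s x" for n x
    unfolding u_def c_transform_def
  proof (rule SUP_mono)
    fix y
    have "s * C (x, y) \<le> (s + real n) * C (x, y)" using C_nonneg by (intro mult_right_mono) auto
    then show "\<exists>y'\<in>UNIV. ennreal (?g y - (s + real n) * C (x, y)) \<le> ennreal (?g y' - s * C (x, y'))"
      by (intro bexI[of _ y] ennreal_leI) auto
  qed
  have ufin: "(\<integral>\<^sup>+ x. u n x \<partial>P) < \<infinity>" for n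
    using nn_integral_mono[of P "u n" "c_transform ?g s"] ule fin by (meson le_less_trans)
  have "AE x in P. c_transform ?g s x \<noteq> \<infinity>"
    using fin cs by (intro nn_integral_PInf_AE) (auto simp: measurable_cong_sets[OF sets_P refl])
  then have "AE x in P. (\<lambda>n. u n x) \<longlonglongrightarrow> ennreal (?g x)"
  proof eventually_elim
    fix x assume "c_transform ?g s x \<noteq> \<infinity>"
    obtain m where "0 < m" "\<And>x. m * norm x \<le> ?g x" using star_gauge_bounds[OF K(1)] by metis
    then show "(\<lambda>n. u n x) \<longlonglongrightarrow> ennreal (?g x)"
      unfolding u_def using \<open>c_transform ?g s x \<noteq> \<infinity>\<close> s star_gauge_nonneg[OF K(1)]
      by (intro c_transform_tendsto continuous_on_star_gauge K(1)) (auto simp: less_top)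
  qed
  then have lim: "(\<lambda>n. \<integral>\<^sup>+ x. u n x \<partial>P) \<longlonglongrightarrow> (\<integral>\<^sup>+ x. ennreal (?g x) \<partial>P)"
    using fin cs ule
    by (intro nn_integral_dominated_convergence[where w = "c_transform ?g s"])
      (auto simp: measurable_cong_sets[OF sets_P refl])
  have "(INF z\<in>{z \<in> B_feasible {0..<\<infinity>} C P. fst z = K}. B_objective 0 P z) \<le> enn2ereal (\<integral>\<^sup>+ x. u n x \<partial>P)" for n
    using dual_point_of_c_transform[OF K, of "s + real n" 0] ufin[of n] s unfolding u_def
    by (intro INF_lower2[of "(K, ereal (s + real n), \<lambda>x. enn2ereal (c_transform ?g (s + real n) x))"]) auto
  then have "(INF z\<in>{z \<in> B_feasible {0..<\<infinity>} C P. fst z = K}. B_objective 0 P z) \<le> enn2ereal (\<integral>\<^sup>+ x. ennreal (?g x) \<partial>P)"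
    by (intro LIMSEQ_le_const[OF tendsto_enn2erealI[OF lim]]) auto
  then show ?thesis by (simp add: A_objective_eq worst_gauge_zero[OF K(1)])
qed

section \<open>Comparison and positivity of the two objectives\<close>

text \<open>Since the ambiguity ball is \<open>{P}\<close>, the diagonal inequality
  \<open>l >= g\<close> suffices. It does not involve \<open>s\<close>, so infinite multipliers are
  covered.\<close>

lemma weak_duality_zero:
  assumes z: "z \<in> B_feasible S C P"
  shows "A_objective C 0 P (fst z) \<le> B_objective 0 P z"
proof -
  obtain K s l where zz: "z = (K, s, l)" by (cases z)
  have z': "(K, s, l) \<in> B_feasible S C P" using z zz by simp
  have K: "star_body K" and l: "l \<in> L1 P" using z' unfolding B_feasible_def by auto
  have "worst_gauge 0 K \<le> (\<integral>\<^sup>+ x. e2ennreal (l x) \<partial>P)"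
    unfolding worst_gauge_zero[OF K]
  proof (rule nn_integral_mono)
    fix x
    have "e2ennreal (ereal (star_gauge K x)) \<le> e2ennreal (l x)"
      by (rule e2ennreal_mono[OF B_feasible_nonneg(1)[OF z']])
    then show "ennreal (star_gauge K x) \<le> e2ennreal (l x)" by (simp add: ennreal_def)
  qed
  then have "enn2ereal (worst_gauge 0 K) \<le> ereal (LINT x|P. real_of_ereal (l x))"
    unfolding L1_nonneg_integral(1)[OF l B_feasible_nonneg(2)[OF z']] by (simp add: less_eq_ennreal.rep_eq)
  then show ?thesis by (simp add: zz A_objective_eq B_objective_def zero_ereal_def[symmetric])
qed

text \<open>For \<open>s = \<infinity>\<close> the constraint is void off the diagonal and reads
  \<open>l >= g\<close> on it, while \<open>s * \<epsilon>\<close> is 0.\<close>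

lemma dual_attained_zero:
  assumes K: "star_body K" "emeasure lborel K \<le> 1"
  shows "\<exists>z\<in>B_feasible {0..} C P. fst z = K \<and> B_objective 0 P z \<le> A_objective C 0 P K"
proof -
  define l where "l x = ereal (star_gauge K x)" for x
  note [measurable] = star_gauge_borel_measurable[OF K(1)]
  have g0: "0 \<le> star_gauge K x" for x by (rule star_gauge_nonneg[OF K(1)])
  have "l \<in> borel_measurable P" unfolding l_def by measurable
  then have l: "l \<in> L1 P" unfolding L1_def l_def
    using nn_integral_gauge_finite[OF K(1)] by (simp add: g0 ennreal_def[symmetric])
  have "ereal (star_gauge K y) \<le> \<infinity> * ereal (C (x, y)) + l x" for x y
  proof (cases "x = y")
    case True
    then show ?thesis by (simp add: l_def zero_ereal_def[symmetric])
  next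
    case False
    then have "0 < C (x, y)" using C_nonneg[of "(x, y)"] C_zero_iff[of x y] by simp
    then show ?thesis by (simp add: l_def)
  qed
  then have "(K, \<infinity>, l) \<in> B_feasible {0..} C P" unfolding B_feasible_def using K l by auto
  moreover have "B_objective 0 P (K, \<infinity>, l) = A_objective C 0 P K"
  proof -
    have "B_objective 0 P (K, \<infinity>, l) = ereal (LINT x|P. real_of_ereal (l x))"
      by (simp add: B_objective_def zero_ereal_def[symmetric])
    also have "\<dots> = enn2ereal (\<integral>\<^sup>+ x. e2ennreal (l x) \<partial>P)"
      by (rule L1_nonneg_integral(1)[OF l]) (simp add: l_def g0)
    finally show ?thesis by (simp add: A_objective_eq worst_gauge_zero[OF K(1)] l_def ennreal_def)
  qed
  ultimately show ?thesis by force
qed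

lemma weak_duality_finite:
  assumes z: "z \<in> B_feasible {0..<\<infinity>} C P" and e: "0 \<le> \<epsilon>"
  shows "A_objective C \<epsilon> P (fst z) \<le> B_objective \<epsilon> P z"
proof -
  obtain K s' l where zz: "z = (K, s', l)" by (cases z)
  then have "0 \<le> s'" "s' < \<infinity>" and l: "l \<in> L1 P" using z unfolding B_feasible_def by auto
  then obtain s where s: "s' = ereal s" "0 \<le> s" by (cases s') auto
  then have z': "(K, ereal s, l) \<in> B_feasible {0..<\<infinity>} C P" using z zz by simp
  show ?thesis
    using weak_duality[OF z' s(2) e] B_objective_eq[OF l B_feasible_nonneg(2)[OF z'] s(2) e]
    by (simp add: zz s(1) A_objective_eq less_eq_ennreal.rep_eq)
qed

lemma dual_attained_pos:
  assumes K: "star_body K" "emeasure lborel K \<le> 1" and e: "0 < \<epsilon>" and fin: "A_objective C \<epsilon> P K < \<infinity>"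
  shows "\<exists>z\<in>B_feasible {0..<\<infinity>} C P. fst z = K \<and> B_objective \<epsilon> P z \<le> A_objective C \<epsilon> P K"
proof -
  have fin': "worst_gauge \<epsilon> K < \<infinity>" using fin unfolding A_objective_eq by (simp add: less_ennreal.rep_eq)
  obtain s where s: "0 < s" and le: "ennreal (s * \<epsilon>) + (\<integral>\<^sup>+ x. c_transform (star_gauge K) s x \<partial>P) \<le> worst_gauge \<epsilon> K"
    using strong_duality[OF K(1) e fin'] by blast
  have "(\<integral>\<^sup>+ x. c_transform (star_gauge K) s x \<partial>P) < \<infinity>"
    using le fin' by (meson le_less_trans le_add_same_cancel2 order_trans zero_le add_increasing order_refl)
  from dual_point_of_c_transform[OF K _ _ this, of \<epsilon>] s e le show ?thesis
    unfolding A_objective_eq by (auto simp: less_eq_ennreal.rep_eq intro!: bexI)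
qed

text \<open>The value dominates \<open>s * \<epsilon>\<close> with the positive slope from strong
  duality, even if \<open>P\<close> is concentrated at the origin.\<close>

lemma A_objective_pos:
  assumes K: "star_body K" and e: "0 < \<epsilon>"
  shows "0 < A_objective C \<epsilon> P K"
proof (cases "worst_gauge \<epsilon> K < \<infinity>")
  case True
  obtain s where s: "0 < s" and le: "ennreal (s * \<epsilon>) + (\<integral>\<^sup>+ x. c_transform (star_gauge K) s x \<partial>P) \<le> worst_gauge \<epsilon> K"
    using strong_duality[OF K e True] by blast
  have "0 < ennreal (s * \<epsilon>)" using s e by (simp add: ennreal_less_zero_iff)
  also have "\<dots> \<le> ennreal (s * \<epsilon>) + (\<integral>\<^sup>+ x. c_transform (star_gauge K) s x \<partial>P)" by simp
  also note le
  finally show ?thesis unfolding A_objective_eq by (simp add: less_ennreal.rep_eq zero_ennreal.rep_eq)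
next
  case False
  then have "worst_gauge \<epsilon> K = \<infinity>" by (metis infinity_ennreal_def top.not_eq_extremum)
  then show ?thesis unfolding A_objective_eq by simp
qed

lemma A_objective_zero_pos:
  assumes K: "star_body K" and P: "P \<noteq> return borel 0"
  shows "0 < A_objective C 0 P K"
proof -
  note [measurable] = star_gauge_borel_measurable[OF K]
  have "(\<integral>\<^sup>+ x. ennreal (star_gauge K x) \<partial>P) \<noteq> 0"
  proof
    assume "(\<integral>\<^sup>+ x. ennreal (star_gauge K x) \<partial>P) = 0"
    then have "AE x in P. ennreal (star_gauge K x) = 0" by (subst (asm) nn_integral_0_iff_AE) auto
    then have ae: "AE x in P. x = 0"
    proof eventually_elim
      fix x assume "ennreal (star_gauge K x) = 0"
      then have "star_gauge K x = 0" using star_gauge_nonneg[OF K, of x] by (simp add: ennreal_eq_0_iff)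
      then show "x = 0" using star_gauge_eq_zero_iff[OF K] by blast
    qed
    have "P = return borel 0"
    proof (rule measure_eqI)
      show "sets P = sets (return borel 0)" by (simp add: sets_P)
      fix A assume "A \<in> sets P"
      then have A: "A \<in> sets borel" by (simp add: sets_P)
      have "emeasure P A = emeasure P (if 0 \<in> A then UNIV else {})"
        by (rule emeasure_eq_AE) (use ae A in \<open>auto simp: sets_P\<close>)
      then show "emeasure P A = emeasure (return borel 0) A"
        using A emeasure_space_1 by (auto simp: indicator_def)
    qed
    then show False using P by blast
  qed
  then show ?thesis unfolding A_objective_eq worst_gauge_zero[OF K]
    by (metis less_ennreal.rep_eq zero_ennreal.rep_eq zero_less_iff_neq_zero)
qed

section \<open>Rescaling to unit volume\<close>

lemma worst_gauge_scale:
  assumes K: "star_body K" and c: "0 < c"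
  shows "worst_gauge \<epsilon> ((*\<^sub>R) c ` K) = ennreal (1 / c) * worst_gauge \<epsilon> K"
proof -
  note [measurable] = star_gauge_borel_measurable[OF K]
  have "(\<integral>\<^sup>+ x. ennreal (star_gauge ((*\<^sub>R) c ` K) x) \<partial>Q) = ennreal (1 / c) * (\<integral>\<^sup>+ x. ennreal (star_gauge K x) \<partial>Q)"
    if "Q \<in> ambiguity_ball C \<epsilon> P" for Q
  proof -
    have [measurable_cong]: "sets Q = sets borel" using that unfolding ambiguity_ball_def distribution_def by blast
    have "ennreal (star_gauge ((*\<^sub>R) c ` K) x) = ennreal (1 / c) * ennreal (star_gauge K x)" for x
      using c star_gauge_nonneg[OF K, of x]
      by (simp add: star_gauge_image_scaleR[OF K c] ennreal_mult[symmetric])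
    then show ?thesis by (simp add: nn_integral_cmult)
  qed
  then show ?thesis unfolding worst_gauge_def SUP_mult_left_ennreal by (simp cong: SUP_cong)
qed

text \<open>Dividing by a factor \<open>c > 1\<close> lowers a value strictly only if the value is
  neither 0 nor \<infinity>.\<close>

lemma unit_volume_improvement:
  assumes K: "star_body K" "emeasure lborel K \<le> 1"
  obtains K' where "K' \<in> A_feasible" "A_objective C \<epsilon> P K' \<le> A_objective C \<epsilon> P K"
    "emeasure lborel K \<noteq> 1 \<Longrightarrow> 0 < A_objective C \<epsilon> P K \<Longrightarrow> A_objective C \<epsilon> P K < \<infinity> \<Longrightarrow>
       A_objective C \<epsilon> P K' < A_objective C \<epsilon> P K"
proof -
  obtain v where v: "0 < v" "emeasure lborel K = ennreal v"
    using star_body_emeasure[OF K(1)] by (cases "emeasure lborel K") (auto simp: ennreal_less_zero_iff)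
  have v1: "v \<le> 1" using K(2) v by (simp add: ennreal_le_1)
  define c where "c = root DIM('a) (1 / v)"
  have cpow: "c ^ DIM('a) = 1 / v" unfolding c_def using v by (intro real_root_pow_pos2) auto
  have c1: "1 \<le> c" unfolding c_def using v v1 by (simp add: real_root_ge_1_iff)
  have "star_body ((*\<^sub>R) c ` K)" using star_body_image_scaleR[OF K(1)] c1 by simp
  moreover have "emeasure lborel ((*\<^sub>R) c ` K) = 1"
  proof -
    have "K \<in> sets borel" using K(1) unfolding star_body_def by (simp add: compact_imp_closed)
    then have "emeasure lborel ((*\<^sub>R) c ` K) = ennreal (1 / v) * ennreal v"
      using c1 by (simp add: emeasure_lborel_image_scaleR cpow v)
    then show ?thesis using v by (simp add: ennreal_mult[symmetric])
  qed
  ultimately have f: "(*\<^sub>R) c ` K \<in> A_feasible" unfolding A_feasible_def by simp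
  have w: "worst_gauge \<epsilon> ((*\<^sub>R) c ` K) = ennreal (1 / c) * worst_gauge \<epsilon> K"
    using c1 by (intro worst_gauge_scale K(1)) simp
  have "ennreal (1 / c) * worst_gauge \<epsilon> K \<le> 1 * worst_gauge \<epsilon> K"
    using c1 by (intro mult_right_mono) (simp_all add: ennreal_le_1)
  then have le: "A_objective C \<epsilon> P ((*\<^sub>R) c ` K) \<le> A_objective C \<epsilon> P K"
    unfolding A_objective_eq w by (simp add: less_eq_ennreal.rep_eq)
  have less: "A_objective C \<epsilon> P ((*\<^sub>R) c ` K) < A_objective C \<epsilon> P K"
    if vol: "emeasure lborel K \<noteq> 1" and pos: "0 < A_objective C \<epsilon> P K" and fin: "A_objective C \<epsilon> P K < \<infinity>"
  proof -
    have "v \<noteq> 1" using vol v by auto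
    then have "1 / v \<noteq> 1" using v by simp
    then have "c \<noteq> 1" using cpow by auto
    then have c: "1 < c" using c1 by simp
    obtain t where t: "0 \<le> t" "worst_gauge \<epsilon> K = ennreal t"
      using fin unfolding A_objective_eq by (cases "worst_gauge \<epsilon> K") auto
    have "0 < t" using pos t unfolding A_objective_eq by (simp add: enn2ereal_ennreal)
    then have "t / c < t" using c by (simp add: field_simps)
    then show ?thesis unfolding A_objective_eq w t(2)
      using t(1) c by (simp add: ennreal_mult[symmetric] enn2ereal_ennreal)
  qed
  show ?thesis using that[OF f le less] .
qed

section \<open>From duality for each body to values and minimizers\<close>

context
  fixes S :: "ereal set" and \<epsilon> :: real
  assumes weak: "\<And>z. z \<in> B_feasible S C P \<Longrightarrow> A_objective C \<epsilon> P (fst z) \<le> B_objective \<epsilon> P z"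
    and strong: "\<And>K. star_body K \<Longrightarrow> emeasure lborel K \<le> 1 \<Longrightarrow> A_objective C \<epsilon> P K < \<infinity> \<Longrightarrow>
      (INF z\<in>{z \<in> B_feasible S C P. fst z = K}. B_objective \<epsilon> P z) \<le> A_objective C \<epsilon> P K"
begin

text \<open>Only the infimum over \<open>s\<close> and \<lambda> is compared, so regimes without an
  optimal multiplier are included; for a body of infinite value the upper bound is trivial.\<close>

lemma reduced_dual_eq:
  assumes K: "star_body K" "emeasure lborel K \<le> 1"
  shows "(INF z\<in>{z \<in> B_feasible S C P. fst z = K}. B_objective \<epsilon> P z) = A_objective C \<epsilon> P K"
proof (rule antisym)
  show "(INF z\<in>{z \<in> B_feasible S C P. fst z = K}. B_objective \<epsilon> P z) \<le> A_objective C \<epsilon> P K"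
    using strong[OF K] by (cases "A_objective C \<epsilon> P K < \<infinity>") auto
  show "A_objective C \<epsilon> P K \<le> (INF z\<in>{z \<in> B_feasible S C P. fst z = K}. B_objective \<epsilon> P z)"
    by (rule INF_greatest) (use weak in auto)
qed

lemma value_eq: "A_value C \<epsilon> P = B_value S C \<epsilon> P"
proof (rule antisym)
  show "A_value C \<epsilon> P \<le> B_value S C \<epsilon> P"
    unfolding B_value_def
  proof (rule INF_greatest)
    fix z assume z: "z \<in> B_feasible S C P"
    then have "star_body (fst z)" "emeasure lborel (fst z) \<le> 1" unfolding B_feasible_def by auto
    then obtain K' where "K' \<in> A_feasible" "A_objective C \<epsilon> P K' \<le> A_objective C \<epsilon> P (fst z)"
      by (rule unit_volume_improvement)
    then show "A_value C \<epsilon> P \<le> B_objective \<epsilon> P z"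
      unfolding A_value_def using weak[OF z] by (meson INF_lower2 order_trans)
  qed
  show "B_value S C \<epsilon> P \<le> A_value C \<epsilon> P"
    unfolding A_value_def
  proof (rule INF_greatest)
    fix K :: "'a set" assume "K \<in> A_feasible"
    then have K: "star_body K" "emeasure lborel K \<le> 1" unfolding A_feasible_def by auto
    have "B_value S C \<epsilon> P \<le> (INF z\<in>{z \<in> B_feasible S C P. fst z = K}. B_objective \<epsilon> P z)"
      unfolding B_value_def by (rule INF_superset_mono) auto
    then show "B_value S C \<epsilon> P \<le> A_objective C \<epsilon> P K" by (simp add: reduced_dual_eq[OF K])
  qed
qed

lemma B_optimal_bodies_iff:
  "K \<in> B_optimal_bodies S C \<epsilon> P \<longleftrightarrow> star_body K \<and> emeasure lborel K \<le> 1 \<and>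
     (\<forall>K'. star_body K' \<and> emeasure lborel K' \<le> 1 \<longrightarrow> A_objective C \<epsilon> P K \<le> A_objective C \<epsilon> P K') \<and>
     A_objective C \<epsilon> P K < \<infinity>"
  unfolding B_optimal_bodies_def argmin_set_iff using reduced_dual_eq by auto

lemma A_argmin_eq: "A_argmin C \<epsilon> P = {K \<in> B_optimal_bodies S C \<epsilon> P. emeasure lborel K = 1}"
proof (intro equalityI subsetI)
  fix K assume "K \<in> A_argmin C \<epsilon> P"
  then have K: "K \<in> A_feasible" "A_objective C \<epsilon> P K < \<infinity>"
    "\<And>K'. K' \<in> A_feasible \<Longrightarrow> A_objective C \<epsilon> P K \<le> A_objective C \<epsilon> P K'"
    unfolding A_argmin_def argmin_set_iff by auto
  have "A_objective C \<epsilon> P K \<le> A_objective C \<epsilon> P K'" if K': "star_body K'" "emeasure lborel K' \<le> 1" for K'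
  proof -
    obtain K'' where "K'' \<in> A_feasible" "A_objective C \<epsilon> P K'' \<le> A_objective C \<epsilon> P K'"
      using K' by (rule unit_volume_improvement)
    then show ?thesis using K(3) order_trans by blast
  qed
  then show "K \<in> {K \<in> B_optimal_bodies S C \<epsilon> P. emeasure lborel K = 1}"
    using K(1,2) unfolding A_feasible_def by (simp add: B_optimal_bodies_iff)
next
  fix K assume "K \<in> {K \<in> B_optimal_bodies S C \<epsilon> P. emeasure lborel K = 1}"
  then show "K \<in> A_argmin C \<epsilon> P"
    unfolding A_argmin_def argmin_set_iff A_feasible_def by (simp add: B_optimal_bodies_iff)
qed

lemma A_argmin_eq_B_optimal_bodies:
  assumes pos: "\<And>K. star_body K \<Longrightarrow> 0 < A_objective C \<epsilon> P K"
  shows "A_argmin C \<epsilon> P = B_optimal_bodies S C \<epsilon> P"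
proof -
  have "emeasure lborel K = 1" if "K \<in> B_optimal_bodies S C \<epsilon> P" for K
  proof (rule ccontr)
    assume vol: "emeasure lborel K \<noteq> 1"
    have K: "star_body K" "emeasure lborel K \<le> 1" "A_objective C \<epsilon> P K < \<infinity>"
      and min: "\<And>K'. star_body K' \<Longrightarrow> emeasure lborel K' \<le> 1 \<Longrightarrow> A_objective C \<epsilon> P K \<le> A_objective C \<epsilon> P K'"
      using \<open>K \<in> B_optimal_bodies S C \<epsilon> P\<close> unfolding B_optimal_bodies_iff by auto
    obtain K' where "K' \<in> A_feasible" "A_objective C \<epsilon> P K' < A_objective C \<epsilon> P K"
      using unit_volume_improvement[OF K(1,2)] vol pos[OF K(1)] K(3) by metis
    then show False using min[of K'] unfolding A_feasible_def by (simp add: not_le[symmetric])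
  qed
  then show ?thesis unfolding A_argmin_eq by blast
qed

text \<open>Attainment supplies each optimal body with an actual multiplier; without it the set of
  minimizing triples could be empty although optimal bodies exist.\<close>

lemma fst_B_argmin_eq:
  assumes attained: "\<And>K. star_body K \<Longrightarrow> emeasure lborel K \<le> 1 \<Longrightarrow> A_objective C \<epsilon> P K < \<infinity> \<Longrightarrow>
      \<exists>z\<in>B_feasible S C P. fst z = K \<and> B_objective \<epsilon> P z \<le> A_objective C \<epsilon> P K"
  shows "fst ` B_argmin S C \<epsilon> P = B_optimal_bodies S C \<epsilon> P"
proof (intro equalityI subsetI)
  fix K assume "K \<in> fst ` B_argmin S C \<epsilon> P"
  then obtain z where zK: "z \<in> B_argmin S C \<epsilon> P" "fst z = K" by blast
  then have z: "z \<in> B_feasible S C P" "fst z = K" "B_objective \<epsilon> P z < \<infinity>"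
    and min: "\<And>z'. z' \<in> B_feasible S C P \<Longrightarrow> B_objective \<epsilon> P z \<le> B_objective \<epsilon> P z'"
    unfolding B_argmin_def argmin_set_iff by blast+
  have K: "star_body K" "emeasure lborel K \<le> 1" using z unfolding B_feasible_def by auto
  have le: "A_objective C \<epsilon> P K \<le> B_objective \<epsilon> P z" using weak[OF z(1)] z(2) by simp
  have "A_objective C \<epsilon> P K \<le> A_objective C \<epsilon> P K'" if K': "star_body K'" "emeasure lborel K' \<le> 1" for K'
  proof (cases "A_objective C \<epsilon> P K' < \<infinity>")
    case True
    then obtain z' where z': "z' \<in> B_feasible S C P" "B_objective \<epsilon> P z' \<le> A_objective C \<epsilon> P K'"
      using attained[OF K'] by blast
    show ?thesis by (rule order_trans[OF le order_trans[OF min[OF z'(1)] z'(2)]])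
  qed simp
  then show "K \<in> B_optimal_bodies S C \<epsilon> P"
    unfolding B_optimal_bodies_iff using K le z(3) by (auto intro: le_less_trans)
next
  fix K assume "K \<in> B_optimal_bodies S C \<epsilon> P"
  then have K: "star_body K" "emeasure lborel K \<le> 1" "A_objective C \<epsilon> P K < \<infinity>"
    and min: "\<And>K'. star_body K' \<Longrightarrow> emeasure lborel K' \<le> 1 \<Longrightarrow> A_objective C \<epsilon> P K \<le> A_objective C \<epsilon> P K'"
    unfolding B_optimal_bodies_iff by auto
  obtain z where z: "z \<in> B_feasible S C P" "fst z = K" "B_objective \<epsilon> P z \<le> A_objective C \<epsilon> P K"
    using attained[OF K] by blast
  have "B_objective \<epsilon> P z \<le> B_objective \<epsilon> P z'" if z': "z' \<in> B_feasible S C P" for z'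
  proof -
    have "star_body (fst z')" "emeasure lborel (fst z') \<le> 1" using z' unfolding B_feasible_def by auto
    then show ?thesis by (rule order_trans[OF z(3) order_trans[OF min weak[OF z']]])
  qed
  then have "z \<in> B_argmin S C \<epsilon> P" unfolding B_argmin_def argmin_set_iff using z K(3) by (auto intro: le_less_trans)
  then show "K \<in> fst ` B_argmin S C \<epsilon> P" using z(2) by blast
qed

end

lemma INF_le_of_attained:
  assumes "\<exists>z\<in>B_feasible S C P. fst z = K \<and> B_objective \<epsilon> P z \<le> A_objective C \<epsilon> P K"
  shows "(INF z\<in>{z \<in> B_feasible S C P. fst z = K}. B_objective \<epsilon> P z) \<le> A_objective C \<epsilon> P K"
  using assms by (auto intro: INF_lower2)

end

text \<open>The case \<open>\<epsilon> = 0\<close> is stated separately because a bounded cost then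
  leaves (B) infeasible for finite \<open>s\<close>: letting \<open>y\<close> go to infinity forces
  \<lambda> to be infinite everywhere, while the value of (A) is finite. Feasibility restores
  equivalence in terms of bodies, and admitting \<open>s = \<infinity>\<close> also restores
  attainment. The point mass at the origin is set apart because every body then has value 0, so
  volume 1 is not forced in (B).\<close>

theorem theorem3p2:
  fixes P :: "(real ^ 'd) measure"
    and C :: "(real ^ 'd) \<times> (real ^ 'd) \<Rightarrow> real"
    and \<epsilon> :: real
  assumes "distribution P"
    and "integrable P (\<lambda>x. norm x)"
    and "\<epsilon> \<ge> 0"
    and "\<And>x y. C (x, y) \<ge> 0"
    and "lsc C"
    and "\<And>x y. C (x, y) = 0 \<longleftrightarrow> x = y"
  shows
    "(\<epsilon> > 0 \<longrightarrow>
        A_value C \<epsilon> P = B_value {0..<\<infinity>} C \<epsilon> P \<and>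
        A_argmin C \<epsilon> P = fst ` B_argmin {0..<\<infinity>} C \<epsilon> P) \<and>
     (\<epsilon> = 0 \<and> B_feasible {0..<\<infinity>} C P \<noteq> {} \<longrightarrow>
        A_value C \<epsilon> P = B_value {0..<\<infinity>} C \<epsilon> P \<and>
        A_argmin C \<epsilon> P = {K \<in> B_optimal_bodies {0..<\<infinity>} C \<epsilon> P. emeasure lborel K = 1} \<and>
        (P \<noteq> return borel 0 \<longrightarrow>
          A_argmin C \<epsilon> P = B_optimal_bodies {0..<\<infinity>} C \<epsilon> P)) \<and>
     (\<epsilon> = 0 \<longrightarrow>
        A_value C \<epsilon> P = B_value {0..} C \<epsilon> P \<and>
        A_argmin C \<epsilon> P = {K \<in> fst ` B_argmin {0..} C \<epsilon> P. emeasure lborel K = 1} \<and>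
        (P \<noteq> return borel 0 \<longrightarrow>
          A_argmin C \<epsilon> P = fst ` B_argmin {0..} C \<epsilon> P))"
proof -
  interpret transport_ambiguity P C
  proof
    show "0 \<le> C z" for z using assms(4)[of "fst z" "snd z"] by simp
  qed (fact assms)+
  have pos: "A_value C \<epsilon> P = B_value {0..<\<infinity>} C \<epsilon> P \<and> A_argmin C \<epsilon> P = fst ` B_argmin {0..<\<infinity>} C \<epsilon> P"
    if "\<epsilon> > 0"
  proof -
    have weak: "A_objective C \<epsilon> P (fst z) \<le> B_objective \<epsilon> P z" if "z \<in> B_feasible {0..<\<infinity>} C P" for z
      using that assms(3) by (rule weak_duality_finite)
    have attained: "\<exists>z\<in>B_feasible {0..<\<infinity>} C P. fst z = K \<and> B_objective \<epsilon> P z \<le> A_objective C \<epsilon> P K"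
      if "star_body K" "emeasure lborel K \<le> 1" "A_objective C \<epsilon> P K < \<infinity>" for K
      using that(1,2) \<open>\<epsilon> > 0\<close> that(3) by (rule dual_attained_pos)
    note dual = weak INF_le_of_attained[OF attained]
    have "A_value C \<epsilon> P = B_value {0..<\<infinity>} C \<epsilon> P"
      by (rule value_eq) (rule dual, assumption+)+
    moreover have "A_argmin C \<epsilon> P = B_optimal_bodies {0..<\<infinity>} C \<epsilon> P"
      by (rule A_argmin_eq_B_optimal_bodies) ((rule dual, assumption+) | (rule A_objective_pos[OF _ \<open>\<epsilon> > 0\<close>], assumption))+
    moreover have "fst ` B_argmin {0..<\<infinity>} C \<epsilon> P = B_optimal_bodies {0..<\<infinity>} C \<epsilon> P"
      by (rule fst_B_argmin_eq) ((rule dual, assumption+) | (rule attained, assumption+))+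
    ultimately show ?thesis by simp
  qed
  have finite_multiplier: "A_value C 0 P = B_value {0..<\<infinity>} C 0 P \<and>
        A_argmin C 0 P = {K \<in> B_optimal_bodies {0..<\<infinity>} C 0 P. emeasure lborel K = 1} \<and>
        (P \<noteq> return borel 0 \<longrightarrow> A_argmin C 0 P = B_optimal_bodies {0..<\<infinity>} C 0 P)"
    if "B_feasible {0..<\<infinity>} C P \<noteq> {}"
  proof -
    note dual = weak_duality_zero dual_infimum_zero[OF that]
    have "A_value C 0 P = B_value {0..<\<infinity>} C 0 P"
      by (rule value_eq) (rule dual, assumption+)+
    moreover have "A_argmin C 0 P = {K \<in> B_optimal_bodies {0..<\<infinity>} C 0 P. emeasure lborel K = 1}"
      by (rule A_argmin_eq) (rule dual, assumption+)+
    moreover have "A_argmin C 0 P = B_optimal_bodies {0..<\<infinity>} C 0 P" if "P \<noteq> return borel 0"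
      by (rule A_argmin_eq_B_optimal_bodies)
        ((rule dual, assumption+) | (rule A_objective_zero_pos[OF _ that], assumption))+
    ultimately show ?thesis by blast
  qed
  have infinite_multiplier: "A_value C 0 P = B_value {0..} C 0 P \<and>
        A_argmin C 0 P = {K \<in> fst ` B_argmin {0..} C 0 P. emeasure lborel K = 1} \<and>
        (P \<noteq> return borel 0 \<longrightarrow> A_argmin C 0 P = fst ` B_argmin {0..} C 0 P)"
  proof -
    note dual = weak_duality_zero INF_le_of_attained[OF dual_attained_zero]
    have "A_value C 0 P = B_value {0..} C 0 P"
      by (rule value_eq) (rule dual, assumption+)+
    moreover have "A_argmin C 0 P = {K \<in> B_optimal_bodies {0..} C 0 P. emeasure lborel K = 1}"
      by (rule A_argmin_eq) (rule dual, assumption+)+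
    moreover have "A_argmin C 0 P = B_optimal_bodies {0..} C 0 P" if "P \<noteq> return borel 0"
      by (rule A_argmin_eq_B_optimal_bodies)
        ((rule dual, assumption+) | (rule A_objective_zero_pos[OF _ that], assumption))+
    moreover have "fst ` B_argmin {0..} C 0 P = B_optimal_bodies {0..} C 0 P"
      by (rule fst_B_argmin_eq) ((rule dual, assumption+) | (rule dual_attained_zero, assumption+))+
    ultimately show ?thesis by simp
  qed
  show ?thesis using pos finite_multiplier infinite_multiplier by blast
qed

end
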